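(* Let $\mathbb{K}$ be an algebraically closed field of characteristic zero, let $Z$ be a closed subvariety of $\mathbb{P}^m$ with a finite automorphism group, and let $X\subseteq\mathbb{K}^{m+1}$ be the affine cone over $Z$. Assume that $X$ is rigid. Then the maximal torus in $\mathrm{Aut}(X)$ is the one-dimensional torus $\mathbb{T}$ acting on $X$ by scalar multiplication. Moreover, $\mathrm{Aut}(X)$ is a finite extension of $\mathbb{T}$ (that is, $\mathbb{T}$ is normal in $\mathrm{Aut}(X)$ and $\mathrm{Aut}(X)/\mathbb{T}$ is finite), and $\mathbb{T}$ is central in $\mathrm{Aut}(X)$.
   Context: $\mathrm{Aut}(X)$ and $\mathrm{Aut}(Z)$ denote the groups of all algebraic automorphisms of the varieties $X$ and $Z$. A subtorus of $\mathrm{Aut}(X)$ is a subgroup with a structure of an algebraic group isomorphic to $(\mathbb{K}^{\times})^s$ for some $s$ such that its action on $X$ is a morphism. An irreducible affine variety $X$ is rigid if it admits no nontrivial regular action of the additive group $(\mathbb{K},+)$. For a rigid affine variety $X$ there is a unique subtorus of $\mathrm{Aut}(X)$ containing all other subtori, called the maximal torus in $\mathrm{Aut}(X)$. *)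

theory Defs
  imports
    "HOL-Analysis.Cartesian_Space"
    "HOL-Algebra.Group_Action"
    "HOL-Algebra.Product_Groups"
    "HOL-Computational_Algebra.Polynomial"
    "HOL-Library.Poly_Mapping"
begin

text \<open>Polynomials over \<open>'a\<close> in variables \<open>'i\<close>; a monomial is its finitely supported exponent function.\<close>

type_synonym ('i, 'a) mpoly = "('i \<Rightarrow>\<^sub>0 nat) \<Rightarrow>\<^sub>0 'a"

definition mpoly_eval :: "('i \<Rightarrow> 'a) \<Rightarrow> ('i, 'a::comm_semiring_1) mpoly \<Rightarrow> 'a"
  where "mpoly_eval v p =
    (\<Sum>m\<in>Poly_Mapping.keys p. Poly_Mapping.lookup p m *
      (\<Prod>i\<in>Poly_Mapping.keys m. v i ^ Poly_Mapping.lookup m i))"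

definition homogeneous_mpoly :: "nat \<Rightarrow> ('i, 'a::zero) mpoly \<Rightarrow> bool"
  where "homogeneous_mpoly d p \<longleftrightarrow>
    (\<forall>m\<in>Poly_Mapping.keys p. (\<Sum>i\<in>Poly_Mapping.keys m. Poly_Mapping.lookup m i) = d)"

text \<open>Irreducibility in the topology whose closed sets are those satisfying \<open>cl\<close>.\<close>

definition irreducible_wrt :: "('p set \<Rightarrow> bool) \<Rightarrow> 'p set \<Rightarrow> bool"
  where "irreducible_wrt cl S \<longleftrightarrow>
    S \<noteq> {} \<and> (\<forall>A B. cl A \<and> cl B \<and> S \<subseteq> A \<union> B \<longrightarrow> S \<subseteq> A \<or> S \<subseteq> B)"


subsection \<open>Affine varieties\<close>

definition affine_closed :: "('a::field ^ 'n) set \<Rightarrow> bool"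
  where "affine_closed X \<longleftrightarrow>
    (\<exists>P :: ('n, 'a) mpoly set. X = {x. \<forall>p\<in>P. mpoly_eval (($) x) p = 0})"

definition affine_variety :: "('a::field ^ 'n) set \<Rightarrow> bool"
  where "affine_variety X \<longleftrightarrow> affine_closed X \<and> irreducible_wrt affine_closed X"

definition affine_morphism ::
    "('a::field ^ 'n) set \<Rightarrow> ('a ^ 'k) set \<Rightarrow> ('a ^ 'n \<Rightarrow> 'a ^ 'k) \<Rightarrow> bool"
  where "affine_morphism X Y f \<longleftrightarrow>
    f \<in> X \<rightarrow> Y \<and> (\<exists>F :: 'k \<Rightarrow> ('n, 'a) mpoly. \<forall>x\<in>X. \<forall>i. f x $ i = mpoly_eval (($) x) (F i))"

text \<open>Self-maps of \<open>X\<close> are taken extensional (as in \<^const>\<open>BijGroup\<close>), so that each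
  automorphism is represented by exactly one function.\<close>

definition aut_group :: "('a::field ^ 'n) set \<Rightarrow> ('a ^ 'n \<Rightarrow> 'a ^ 'n) monoid"
  where "aut_group X = BijGroup X \<lparr>carrier :=
    {f \<in> Bij X. affine_morphism X X f \<and> affine_morphism X X (inv_into X f)}\<rparr>"


subsection \<open>Regular actions\<close>

text \<open>The group variety has underlying set \<open>G\<close>, embedded in affine space by the coordinate
  functions \<open>c\<close>. Morphisms from \<open>G \<times> X\<close> are thus given by polynomials in the coordinates
  \<open>c g\<close> of \<open>g\<close> (variables \<open>Inl k\<close>) and the coordinates of \<open>x\<close> (variables \<open>Inr i\<close>).\<close>

definition action_morphism ::
    "'g set \<Rightarrow> ('g \<Rightarrow> 'k \<Rightarrow> 'a::field) \<Rightarrow> ('a ^ 'n) set \<Rightarrow> ('g \<Rightarrow> 'a ^ 'n \<Rightarrow> 'a ^ 'n) \<Rightarrow> bool"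
  where "action_morphism G c X \<alpha> \<longleftrightarrow>
    (\<exists>F :: 'n \<Rightarrow> ('k + 'n, 'a) mpoly.
      \<forall>g\<in>G. \<forall>x\<in>X. \<forall>i. \<alpha> g x $ i = mpoly_eval (case_sum (c g) (($) x)) (F i))"

definition Ga :: "'a::field monoid"
  where "Ga = \<lparr>carrier = UNIV, monoid.mult = (+), one = 0\<rparr>"

definition Ga_action :: "('a::field ^ 'n) set \<Rightarrow> ('a \<Rightarrow> 'a ^ 'n \<Rightarrow> 'a ^ 'n) \<Rightarrow> bool"
  where "Ga_action X \<alpha> \<longleftrightarrow>
    group_action Ga X \<alpha> \<and> action_morphism UNIV (\<lambda>s (_::unit). s) X \<alpha>"

definition rigid :: "('a::field ^ 'n) set \<Rightarrow> bool"
  where "rigid X \<longleftrightarrow> affine_variety X \<and> (\<forall>\<alpha>. Ga_action X \<alpha> \<longrightarrow> (\<forall>s. \<forall>x\<in>X. \<alpha> s x = x))"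


subsection \<open>Tori\<close>

definition Gm :: "'a::field monoid"
  where "Gm = \<lparr>carrier = UNIV - {0}, monoid.mult = (*), one = 1\<rparr>"

definition torus :: "nat \<Rightarrow> (nat \<Rightarrow> 'a::field) monoid"
  where "torus s = product_group {..<s} (\<lambda>_. Gm)"

text \<open>The torus of dimension \<open>s\<close> is the closed subset \<open>t\<^sub>k u\<^sub>k = 1\<close> of affine \<open>2s\<close>-space, so its
  regular functions are the polynomials in the \<open>t\<^sub>k\<close> and their inverses. The coordinate
  functions with \<open>k \<ge> s\<close> are set to zero and contribute nothing.\<close>

definition torus_coords :: "nat \<Rightarrow> (nat \<Rightarrow> 'a::field) \<Rightarrow> nat + nat \<Rightarrow> 'a"
  where "torus_coords s t = case_sum
    (\<lambda>k. if k < s then t k else 0) (\<lambda>k. if k < s then inverse (t k) else 0)"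

definition subtorus_of_dim ::
    "nat \<Rightarrow> ('a::field ^ 'n) set \<Rightarrow> ('a ^ 'n \<Rightarrow> 'a ^ 'n) set \<Rightarrow> bool"
  where "subtorus_of_dim s X T \<longleftrightarrow>
    subgroup T (aut_group X) \<and>
    (\<exists>\<phi> \<in> iso (torus s) ((aut_group X)\<lparr>carrier := T\<rparr>).
      action_morphism (carrier (torus s)) (torus_coords s) X \<phi>)"

definition subtorus :: "('a::field ^ 'n) set \<Rightarrow> ('a ^ 'n \<Rightarrow> 'a ^ 'n) set \<Rightarrow> bool"
  where "subtorus X T \<longleftrightarrow> (\<exists>s. subtorus_of_dim s X T)"

definition is_maximal_torus :: "('a::field ^ 'n) set \<Rightarrow> ('a ^ 'n \<Rightarrow> 'a ^ 'n) set \<Rightarrow> bool"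
  where "is_maximal_torus X T \<longleftrightarrow> subtorus X T \<and> (\<forall>S. subtorus X S \<longrightarrow> S \<subseteq> T)"

definition scalar_torus :: "('a::field ^ 'n) set \<Rightarrow> ('a ^ 'n \<Rightarrow> 'a ^ 'n) set"
  where "scalar_torus X = {\<lambda>x\<in>X. c *s x | c. c \<noteq> 0}"


subsection \<open>Projective varieties\<close>

text \<open>A point of the projective space of \<open>'a ^ 'n\<close>, of dimension \<open>CARD('n) - 1\<close>, is a line
  through the origin.\<close>

definition proj_space :: "('a::field ^ 'n) set set"
  where "proj_space = {vec.span {x} | x. x \<noteq> 0}"

definition proj_closed :: "('a::field ^ 'n) set set \<Rightarrow> bool"
  where "proj_closed Z \<longleftrightarrow>
    (\<exists>P :: ('n, 'a) mpoly set. (\<forall>p\<in>P. \<exists>d. homogeneous_mpoly d p) \<and>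
      Z = {L \<in> proj_space. \<forall>p\<in>P. \<forall>x\<in>L. mpoly_eval (($) x) p = 0})"

definition proj_variety :: "('a::field ^ 'n) set set \<Rightarrow> bool"
  where "proj_variety Z \<longleftrightarrow> proj_closed Z \<and> irreducible_wrt proj_closed Z"

text \<open>Morphisms are given, on a Zariski open neighbourhood (the complement of \<open>C\<close>) of each
  point, by forms of a common degree without common zero on that neighbourhood.\<close>

definition proj_morphism ::
    "('a::field ^ 'n) set set \<Rightarrow> ('a ^ 'k) set set \<Rightarrow> (('a ^ 'n) set \<Rightarrow> ('a ^ 'k) set) \<Rightarrow> bool"
  where "proj_morphism Z W f \<longleftrightarrow>
    f \<in> Z \<rightarrow> W \<and>
    (\<forall>L\<in>Z. \<exists>C d. \<exists>F :: 'k \<Rightarrow> ('n, 'a) mpoly.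
      proj_closed C \<and> L \<notin> C \<and> (\<forall>i. homogeneous_mpoly d (F i)) \<and>
      (\<forall>M \<in> Z - C. \<forall>x \<in> M - {0}.
        (\<chi> i. mpoly_eval (($) x) (F i)) \<noteq> 0 \<and>
        f M = vec.span {\<chi> i. mpoly_eval (($) x) (F i)}))"

definition proj_aut_group :: "('a::field ^ 'n) set set \<Rightarrow> (('a ^ 'n) set \<Rightarrow> ('a ^ 'n) set) monoid"
  where "proj_aut_group Z = BijGroup Z \<lparr>carrier :=
    {f \<in> Bij Z. proj_morphism Z Z f \<and> proj_morphism Z Z (inv_into Z f)}\<rparr>"

definition affine_cone :: "('a::field ^ 'n) set set \<Rightarrow> ('a ^ 'n) set"
  where "affine_cone Z = insert 0 (\<Union>Z)"

end

theory Submission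
  imports Defs "HOL-Library.Function_Algebras" "HOL-Algebra.FiniteProduct"
begin

text \<open>
  Let \<open>K\<close> be the ground field and \<open>T\<close> the torus of scalar multiplications.

  A locally nilpotent derivation of \<open>K[X]\<close> exponentiates to an action of the additive group, so
  rigidity means that \<open>K[X]\<close> has no such derivation except zero (\<open>eq_zero_if_rigid\<close>). This forces any
  two regular actions of \<open>K\<^sup>\<times>\<close> on \<open>X\<close> to commute (\<open>Gm_actions_commute\<close>). Indeed, an action of
  \<open>K\<^sup>\<times>\<close> is a grading of \<open>K[X]\<close> by the integers. Let \<open>D\<close> be the derivation that multiplies the part
  of weight \<open>w\<close> for the second grading by \<open>w\<close>. It is a finite sum of derivations that are homogeneous for
  the first grading. Every element lies in a finite-dimensional \<open>D\<close>-stable space, so iterating the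
  component of highest degree, if that degree is positive, eventually leads out of the degrees that
  occur in this space: the component is locally nilpotent, hence zero. The same holds for negative
  degrees. So \<open>D\<close> preserves the first grading, and since the characteristic is zero the eigenspaces
  of \<open>D\<close> are the weight spaces of the second grading; hence the two gradings are compatible.

  On the cone one of the two actions can be taken to be the scalar one. So every action of \<open>K\<^sup>\<times>\<close>
  commutes with the scalars, is therefore given by linear forms, and permutes the lines that are
  the points of \<open>Z\<close>. This gives a homomorphism from \<open>K\<^sup>\<times>\<close> to the finite group \<open>Aut(Z)\<close>, which is trivial
  because \<open>K\<^sup>\<times>\<close> is divisible. So every line of the cone is preserved, and as \<open>X\<close> is irreducible
  it lies in a single eigenspace: the action is by scalars
  (\<open>Gm_action_mem_scalar_torus\<close>). Applied to the factors of an arbitrary torus in \<open>Aut(X)\<close>, this puts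
  the torus inside \<open>T\<close>, so \<open>T\<close> is the maximal torus.

  Conjugating the scalars by \<open>g \<in> Aut(X)\<close> is again an action of \<open>K\<^sup>\<times>\<close>, hence by scalars, so
  \<open>g(t x) = P(t) g(x)\<close> with a polynomial \<open>P\<close>. For the inverse of \<open>g\<close> there is likewise a polynomial \<open>Q\<close>, and
  \<open>Q(P(t)) = t\<close> leaves only \<open>P(t) = t\<close>: the torus \<open>T\<close> is central. Consequently the whole of \<open>Aut(X)\<close> acts on
  \<open>Z\<close>, and the elements that act trivially are the scalars, again by irreducibility. Thus \<open>Aut(X)/T\<close> embeds
  into \<open>Aut(Z)\<close> and is finite.
\<close>

section \<open>Gradings and derivations of function algebras\<close>

text \<open>Identities between functions are mostly derived from the ring laws of the function space, which
  works only if the simplifier does not pass to values at points by itself.\<close>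

lemmas pointwise = plus_fun_apply times_fun_apply zero_fun_apply

declare pointwise [simp del]

text \<open>An algebra of functions with values in a field. A scalar multiple is written as the product with
  a constant function; the constants themselves need not belong to the algebra, since later its
  members vanish outside a variety.\<close>

locale function_algebra =
  fixes A :: "('x \<Rightarrow> 'k::field_char_0) set"
  assumes zero_closed [simp]: "0 \<in> A"
    and add_closed [simp]: "f \<in> A \<Longrightarrow> g \<in> A \<Longrightarrow> f + g \<in> A"
    and mult_closed [simp]: "f \<in> A \<Longrightarrow> g \<in> A \<Longrightarrow> f * g \<in> A"
    and scale_closed [simp]: "f \<in> A \<Longrightarrow> (\<lambda>_. c) * f \<in> A"
begin

lemma sum_closed: "(\<And>i. i \<in> I \<Longrightarrow> F i \<in> A) \<Longrightarrow> sum F I \<in> A"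
  by (induction I rule: infinite_finite_induct) auto

definition derivation :: "(('x \<Rightarrow> 'k) \<Rightarrow> ('x \<Rightarrow> 'k)) \<Rightarrow> bool"
  where "derivation \<delta> \<longleftrightarrow>
    (\<forall>f\<in>A. \<delta> f \<in> A) \<and>
    (\<forall>f\<in>A. \<forall>g\<in>A. \<delta> (f + g) = \<delta> f + \<delta> g) \<and>
    (\<forall>c. \<forall>f\<in>A. \<delta> ((\<lambda>_. c) * f) = (\<lambda>_. c) * \<delta> f) \<and>
    (\<forall>f\<in>A. \<forall>g\<in>A. \<delta> (f * g) = f * \<delta> g + g * \<delta> f)"

lemma derivationD:
  assumes "derivation \<delta>"
  shows "f \<in> A \<Longrightarrow> \<delta> f \<in> A"
    and "f \<in> A \<Longrightarrow> g \<in> A \<Longrightarrow> \<delta> (f + g) = \<delta> f + \<delta> g"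
    and "f \<in> A \<Longrightarrow> \<delta> ((\<lambda>_. c) * f) = (\<lambda>_. c) * \<delta> f"
    and "f \<in> A \<Longrightarrow> g \<in> A \<Longrightarrow> \<delta> (f * g) = f * \<delta> g + g * \<delta> f"
  using assms by (auto simp: derivation_def)

lemma derivation_zero: "derivation \<delta> \<Longrightarrow> \<delta> 0 = 0"
  using derivationD(2)[of \<delta> 0 0] by simp

lemma derivation_sum:
  assumes "derivation \<delta>" "\<And>i. i \<in> I \<Longrightarrow> F i \<in> A"
  shows "\<delta> (sum F I) = (\<Sum>i\<in>I. \<delta> (F i))"
  using assms(2)
  by (induction I rule: infinite_finite_induct)
     (auto simp: derivation_zero[OF assms(1)] derivationD[OF assms(1)] sum_closed)

lemma derivation_power:
  assumes "derivation \<delta>"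
  shows "f \<in> A \<Longrightarrow> (\<delta> ^^ n) f \<in> A"
    and "f \<in> A \<Longrightarrow> g \<in> A \<Longrightarrow> (\<delta> ^^ n) (f + g) = (\<delta> ^^ n) f + (\<delta> ^^ n) g"
    and "f \<in> A \<Longrightarrow> (\<delta> ^^ n) ((\<lambda>_. c) * f) = (\<lambda>_. c) * (\<delta> ^^ n) f"
    and "(\<delta> ^^ n) 0 = 0"
proof -
  show *: "(\<delta> ^^ n) f \<in> A" if "f \<in> A" for f n
    using that by (induction n) (auto simp: derivationD[OF assms])
  show "f \<in> A \<Longrightarrow> g \<in> A \<Longrightarrow> (\<delta> ^^ n) (f + g) = (\<delta> ^^ n) f + (\<delta> ^^ n) g"
    by (induction n) (auto simp: derivationD[OF assms] *)
  show "f \<in> A \<Longrightarrow> (\<delta> ^^ n) ((\<lambda>_. c) * f) = (\<lambda>_. c) * (\<delta> ^^ n) f"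
    by (induction n) (auto simp: derivationD[OF assms] *)
  show "(\<delta> ^^ n) 0 = 0"
    by (induction n) (auto simp: derivation_zero[OF assms])
qed

definition locally_nilpotent :: "(('x \<Rightarrow> 'k) \<Rightarrow> ('x \<Rightarrow> 'k)) \<Rightarrow> bool"
  where "locally_nilpotent \<delta> \<longleftrightarrow> (\<forall>f\<in>A. \<exists>n. (\<delta> ^^ n) f = 0)"

end

text \<open>A grading by the integers, encoded by the projections \<open>C w\<close> onto its homogeneous parts: \<open>f\<close> is
  homogeneous of degree \<open>w\<close> iff \<open>C w f = f\<close>.\<close>

locale grading = function_algebra A for A :: "('x \<Rightarrow> 'k::field_char_0) set" +
  fixes C :: "int \<Rightarrow> ('x \<Rightarrow> 'k) \<Rightarrow> ('x \<Rightarrow> 'k)"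
  assumes comp_closed [simp]: "f \<in> A \<Longrightarrow> C w f \<in> A"
    and comp_add: "f \<in> A \<Longrightarrow> g \<in> A \<Longrightarrow> C w (f + g) = C w f + C w g"
    and comp_scale: "f \<in> A \<Longrightarrow> C w ((\<lambda>_. c) * f) = (\<lambda>_. c) * C w f"
    and finite_support: "f \<in> A \<Longrightarrow> finite {w. C w f \<noteq> 0}"
    and sum_support: "f \<in> A \<Longrightarrow> (\<Sum>w | C w f \<noteq> 0. C w f) = f"
    and comp_comp: "f \<in> A \<Longrightarrow> C v (C w f) = (if v = w then C w f else 0)"
    and comp_mult: "f \<in> A \<Longrightarrow> g \<in> A \<Longrightarrow> C u f = f \<Longrightarrow> C v g = g \<Longrightarrow> C (u + v) (f * g) = f * g"
begin

lemma comp_zero [simp]: "C w 0 = 0"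
  using comp_add[of 0 0 w] by simp

lemma comp_sum:
  "(\<And>i. i \<in> I \<Longrightarrow> F i \<in> A) \<Longrightarrow> C w (sum F I) = (\<Sum>i\<in>I. C w (F i))"
  by (induction I rule: infinite_finite_induct) (auto simp: comp_add sum_closed)

lemma comp_homogeneous: "f \<in> A \<Longrightarrow> C d f = f \<Longrightarrow> C v f = (if v = d then f else 0)"
  using comp_comp[of f v d] by simp

lemma eq_if_comp_eq:
  assumes "f \<in> A" "g \<in> A" and eq: "\<And>w. C w f = C w g"
  shows "f = g"
proof -
  have "(\<Sum>w | C w f \<noteq> 0. C w f) = (\<Sum>w | C w g \<noteq> 0. C w g)"
    unfolding eq ..
  then show ?thesis
    unfolding sum_support[OF assms(1)] sum_support[OF assms(2)] .
qed

lemma homogeneous_induct [consumes 1, case_names homogeneous add]: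
  assumes "f \<in> A"
    and hom: "\<And>w f. f \<in> A \<Longrightarrow> C w f = f \<Longrightarrow> P f"
    and add: "\<And>f g. f \<in> A \<Longrightarrow> g \<in> A \<Longrightarrow> P f \<Longrightarrow> P g \<Longrightarrow> P (f + g)"
  shows "P f"
proof -
  have "P (\<Sum>w\<in>W. C w f)" for W
  proof (induction W rule: infinite_finite_induct)
    case (insert w W)
    then show ?case
      using add[of "C w f" "\<Sum>w\<in>W. C w f"] hom[of "C w f" w] \<open>f \<in> A\<close>
      by (simp add: sum_closed comp_comp)
  qed (use hom[of 0] in auto)
  then show ?thesis
    using sum_support[OF \<open>f \<in> A\<close>] by metis
qed

lemma comp_mult_homogeneous:
  assumes "f \<in> A" "C d f = f" "g \<in> A"
  shows "C (d + m) (f * g) = f * C m g"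
  using assms(3)
proof (induction g rule: homogeneous_induct)
  case (homogeneous e g)
  then have "C (d + e) (f * g) = f * g"
    using assms comp_mult by blast
  then show ?case
    using homogeneous assms comp_homogeneous[of "f * g" "d + e" "d + m"] comp_homogeneous[of g e m]
    by auto
next
  case (add g h)
  then show ?case
    using assms by (simp add: distrib_left comp_add)
qed

definition euler :: "('x \<Rightarrow> 'k) \<Rightarrow> ('x \<Rightarrow> 'k)"
  where "euler f = (\<Sum>w | C w f \<noteq> 0. (\<lambda>_. of_int w) * C w f)"

lemma euler_closed [simp]: "f \<in> A \<Longrightarrow> euler f \<in> A"
  unfolding euler_def by (intro sum_closed) simp

lemma comp_euler:
  assumes "f \<in> A"
  shows "C v (euler f) = (\<lambda>_. of_int v) * C v f"
proof -
  have "C v (euler f) = (\<Sum>w | C w f \<noteq> 0. C v ((\<lambda>_. of_int w) * C w f))"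
    unfolding euler_def using assms by (intro comp_sum) simp
  also have "\<dots> = (\<Sum>w | C w f \<noteq> 0. if w = v then (\<lambda>_. of_int v) * C v f else 0)"
    using assms by (intro sum.cong) (auto simp: comp_scale comp_comp)
  also have "\<dots> = (\<lambda>_. of_int v) * C v f"
    using finite_support[OF assms] by (auto simp: sum.delta)
  finally show ?thesis .
qed

lemma euler_homogeneous:
  assumes "f \<in> A" "C w f = f"
  shows "euler f = (\<lambda>_. of_int w) * f"
proof (rule eq_if_comp_eq)
  fix v show "C v (euler f) = C v ((\<lambda>_. of_int w) * f)"
    using comp_homogeneous[OF assms, of v] assms by (simp add: comp_euler comp_scale)
qed (use assms in auto)

lemma euler_add: "f \<in> A \<Longrightarrow> g \<in> A \<Longrightarrow> euler (f + g) = euler f + euler g"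
  by (rule eq_if_comp_eq) (auto simp: comp_euler comp_add distrib_left)

lemma derivation_euler: "derivation euler"
  unfolding derivation_def
proof (intro conjI ballI allI)
  fix f g assume f: "f \<in> A" and g: "g \<in> A"
  show "euler (f * g) = f * euler g + g * euler f"
    using f
  proof (induction f rule: homogeneous_induct)
    case (homogeneous u f)
    show ?case
      using g
    proof (induction g rule: homogeneous_induct)
      case (homogeneous v g)
      have "euler (f * g) = (\<lambda>_. of_int (u + v)) * (f * g)"
        using homogeneous \<open>f \<in> A\<close> \<open>C u f = f\<close> by (intro euler_homogeneous comp_mult) auto
      moreover have "euler f = (\<lambda>_. of_int u) * f" "euler g = (\<lambda>_. of_int v) * g"
        using homogeneous \<open>f \<in> A\<close> \<open>C u f = f\<close> by (auto intro: euler_homogeneous)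
      ultimately show ?case
        by (simp only:) (simp add: fun_eq_iff pointwise algebra_simps)
    next
      case (add g h)
      then show ?case
        using homogeneous by (simp add: distrib_left distrib_right euler_add algebra_simps)
    qed
  next
    case (add f h)
    then show ?case
      using g by (simp add: distrib_left distrib_right euler_add algebra_simps)
  qed
next
  fix c f assume "f \<in> A"
  then show "euler ((\<lambda>_. c) * f) = (\<lambda>_. c) * euler f"
    by - (rule eq_if_comp_eq, auto simp: comp_euler comp_scale mult.left_commute)
qed (auto simp: euler_add)

text \<open>In characteristic zero different degrees are different eigenvalues of the Euler derivation, so
  the grading can be recovered from it.\<close>

lemma euler_eigenvector:
  assumes "f \<in> A" "euler f = (\<lambda>_. of_int w) * f"
  shows "C w f = f"
proof (rule eq_if_comp_eq)
  fix v
  have "(\<lambda>_. of_int v) * C v f = (\<lambda>_. of_int w) * C v f"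
    using comp_euler[OF assms(1), of v] assms by (simp add: comp_scale)
  then have "C v f = 0" if "v \<noteq> w"
    using that by (auto simp: fun_eq_iff pointwise)
  then show "C v (C w f) = C v f"
    using assms by (auto simp: comp_comp)
qed (use assms in auto)

lemma euler_power:
  assumes "f \<in> A"
  shows "(euler ^^ n) f = (\<Sum>w | C w f \<noteq> 0. (\<lambda>_. of_int w ^ n) * C w f)"
proof (induction n)
  case 0
  have "(\<lambda>_. 1 :: 'k) * C w f = C w f" for w by (simp add: fun_eq_iff pointwise)
  then show ?case
    using sum_support[OF assms] by (simp add: one_fun_def[symmetric])
next
  case (Suc n)
  have "(euler ^^ Suc n) f = (\<Sum>w | C w f \<noteq> 0. euler ((\<lambda>_. of_int w ^ n) * C w f))"
    using assms by (simp add: Suc derivation_sum[OF derivation_euler])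
  also have "\<dots> = (\<Sum>w | C w f \<noteq> 0. (\<lambda>_. of_int w ^ Suc n) * C w f)"
  proof (intro sum.cong refl)
    fix w
    have "euler ((\<lambda>_. of_int w ^ n) * C w f) = (\<lambda>_. of_int w ^ n) * ((\<lambda>_. of_int w) * C w f)"
      using assms by (simp add: derivationD(3)[OF derivation_euler] euler_homogeneous[of _ w] comp_comp)
    then show "euler ((\<lambda>_. of_int w ^ n) * C w f) = (\<lambda>_. of_int w ^ Suc n) * C w f"
      by (simp add: fun_eq_iff pointwise)
  qed
  finally show ?case .
qed

text \<open>The part of \<open>\<delta>\<close> that raises degrees by \<open>k\<close>.\<close>

definition degree_component ::
    "(('x \<Rightarrow> 'k) \<Rightarrow> ('x \<Rightarrow> 'k)) \<Rightarrow> int \<Rightarrow> ('x \<Rightarrow> 'k) \<Rightarrow> ('x \<Rightarrow> 'k)"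
  where "degree_component \<delta> k f = (\<Sum>d | C d f \<noteq> 0. C (d + k) (\<delta> (C d f)))"

context
  fixes \<delta> assumes \<delta>: "derivation \<delta>"
begin

lemma degree_component_closed [simp]: "f \<in> A \<Longrightarrow> degree_component \<delta> k f \<in> A"
  unfolding degree_component_def by (intro sum_closed) (simp add: derivationD(1)[OF \<delta>])

lemma comp_degree_component:
  assumes "f \<in> A"
  shows "C v (degree_component \<delta> k f) = C v (\<delta> (C (v - k) f))"
proof -
  have "C v (degree_component \<delta> k f) = (\<Sum>d | C d f \<noteq> 0. C v (C (d + k) (\<delta> (C d f))))"
    unfolding degree_component_def using assms by (intro comp_sum) (simp add: derivationD(1)[OF \<delta>])
  also have "\<dots> = (\<Sum>d | C d f \<noteq> 0. if d = v - k then C v (\<delta> (C (v - k) f)) else 0)"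
    using assms by (intro sum.cong) (auto simp: comp_comp derivationD(1)[OF \<delta>])
  also have "\<dots> = C v (\<delta> (C (v - k) f))"
    using finite_support[OF assms] by (auto simp: sum.delta derivation_zero[OF \<delta>])
  finally show ?thesis .
qed

lemma degree_component_homogeneous:
  assumes "f \<in> A" "C d f = f"
  shows "degree_component \<delta> k f = C (d + k) (\<delta> f)"
proof (rule eq_if_comp_eq)
  fix v
  show "C v (degree_component \<delta> k f) = C v (C (d + k) (\<delta> f))"
    using comp_homogeneous[OF assms, of "v - k"] assms
    by (auto simp: comp_degree_component comp_comp derivationD(1)[OF \<delta>] derivation_zero[OF \<delta>])
qed (use assms in \<open>auto simp: derivationD(1)[OF \<delta>]\<close>)

lemma degree_component_add:
  "f \<in> A \<Longrightarrow> g \<in> A \<Longrightarrow>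
    degree_component \<delta> k (f + g) = degree_component \<delta> k f + degree_component \<delta> k g"
  by (rule eq_if_comp_eq) (auto simp: comp_degree_component comp_add derivationD[OF \<delta>])

text \<open>The product rule is biadditive, so it suffices to check it on homogeneous \<open>f\<close> and \<open>g\<close>; there it is
  the part of degree \<open>deg f + deg g + k\<close> of the product rule of \<open>\<delta>\<close>.\<close>

lemma derivation_degree_component: "derivation (degree_component \<delta> k)"
  unfolding derivation_def
proof (intro conjI ballI allI)
  let ?\<delta> = "degree_component \<delta> k"
  fix f g assume f: "f \<in> A" and g: "g \<in> A"
  show "?\<delta> (f * g) = f * ?\<delta> g + g * ?\<delta> f"
    using f
  proof (induction f rule: homogeneous_induct)
    case (homogeneous d f)
    show ?case
      using g
    proof (induction g rule: homogeneous_induct)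
      case hom2: (homogeneous e g)
      have "?\<delta> (f * g) = C (d + (e + k)) (f * \<delta> g + g * \<delta> f)"
        using homogeneous hom2 degree_component_homogeneous[of "f * g" "d + e" k]
          comp_mult[of f g d e]
        by (simp add: derivationD(4)[OF \<delta>] add.assoc)
      also have "\<dots> = C (d + (e + k)) (f * \<delta> g) + C (e + (d + k)) (g * \<delta> f)"
        using homogeneous hom2 by (simp add: comp_add derivationD(1)[OF \<delta>] algebra_simps)
      also have "\<dots> = f * C (e + k) (\<delta> g) + g * C (d + k) (\<delta> f)"
        using homogeneous hom2 by (simp only: comp_mult_homogeneous derivationD(1)[OF \<delta>])
      finally show ?case
        using homogeneous hom2 by (simp add: degree_component_homogeneous)
    next
      case (add g h)
      then show ?case
        using homogeneous by (simp add: distrib_left distrib_right degree_component_add algebra_simps)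
    qed
  next
    case (add f h)
    then show ?case
      using g by (simp add: distrib_left distrib_right degree_component_add algebra_simps)
  qed
next
  fix c f assume "f \<in> A"
  then show "degree_component \<delta> k ((\<lambda>_. c) * f) = (\<lambda>_. c) * degree_component \<delta> k f"
    by - (rule eq_if_comp_eq, auto simp: comp_degree_component comp_scale derivationD[OF \<delta>])
qed (auto simp: degree_component_add)

text \<open>For \<open>f\<close> homogeneous of degree \<open>d\<close>, the \<open>n\<close>-th iterate of the top component on \<open>f\<close> is the part of
  degree \<open>d + n k\<close> of the \<open>n\<close>-th iterate of \<open>\<delta>\<close> on \<open>f\<close>. By local finiteness only finitely many degrees occur in all
  these iterates together, and \<open>d + n k\<close> takes infinitely many values.\<close>

lemma top_degree_component_locally_nilpotent:
  assumes locally_finite: "\<And>f. f \<in> A \<Longrightarrow> finite {e. \<exists>n. C e ((\<delta> ^^ n) f) \<noteq> 0}"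
    and "k > 0"
    and top: "\<And>j f. j > k \<Longrightarrow> f \<in> A \<Longrightarrow> degree_component \<delta> j f = 0"
  shows "locally_nilpotent (degree_component \<delta> k)"
  unfolding locally_nilpotent_def
proof
  let ?\<delta> = "degree_component \<delta> k"
  fix f assume "f \<in> A"
  then show "\<exists>n. (?\<delta> ^^ n) f = 0"
  proof (induction f rule: homogeneous_induct)
    case (homogeneous d f)
    have closed: "(\<delta> ^^ n) f \<in> A" for n
      using homogeneous derivation_power(1)[OF \<delta>] by simp
    have comp_\<delta>: "C m (\<delta> h) = (\<Sum>e | C e h \<noteq> 0. C m (degree_component \<delta> (m - e) (C e h)))"
      if "h \<in> A" for h m
    proof -
      have "C m (\<delta> h) = C m (\<delta> (\<Sum>e | C e h \<noteq> 0. C e h))"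
        using sum_support[OF that] by simp
      also have "\<dots> = (\<Sum>e | C e h \<noteq> 0. C m (\<delta> (C e h)))"
        using that by (simp add: derivation_sum[OF \<delta>] comp_sum derivationD(1)[OF \<delta>])
      also have "\<dots> = (\<Sum>e | C e h \<noteq> 0. C m (degree_component \<delta> (m - e) (C e h)))"
        using that by (intro sum.cong) (auto simp: comp_degree_component comp_comp)
      finally show ?thesis .
    qed
    \<comment> \<open>each step raises degrees by at most \<open>k\<close>, and only the component of degree \<open>k\<close> reaches the bound\<close>
    have "(\<forall>e > d + int n * k. C e ((\<delta> ^^ n) f) = 0) \<and>
        C (d + int n * k) ((\<delta> ^^ n) f) = (?\<delta> ^^ n) f" for n
    proof (induction n)
      case 0
      then show ?case
        using comp_homogeneous[OF homogeneous] by auto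
    next
      case (Suc n)
      let ?h = "(\<delta> ^^ n) f" and ?d = "d + int n * k"
      have h: "?h \<in> A" by (rule closed)
      have le: "e \<le> ?d" if "C e ?h \<noteq> 0" for e
        using Suc that by (meson not_le)
      have "C m (\<delta> ?h) = 0" if "m > ?d + k" for m
        unfolding comp_\<delta>[OF h]
      proof (intro sum.neutral ballI)
        fix e assume "e \<in> {e. C e ?h \<noteq> 0}"
        then have "m - e > k" using le[of e] that by simp
        then show "C m (degree_component \<delta> (m - e) (C e ?h)) = 0"
          using top h by simp
      qed
      moreover have "C (?d + k) (\<delta> ?h) = ?\<delta> (C ?d ?h)"
      proof -
        have "C (?d + k) (\<delta> ?h) =
            (\<Sum>e | C e ?h \<noteq> 0. if e = ?d then ?\<delta> (C ?d ?h) else 0)"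
          unfolding comp_\<delta>[OF h]
        proof (intro sum.cong refl)
          fix e assume e: "e \<in> {e. C e ?h \<noteq> 0}"
          show "C (?d + k) (degree_component \<delta> (?d + k - e) (C e ?h)) =
              (if e = ?d then ?\<delta> (C ?d ?h) else 0)"
          proof (cases "e = ?d")
            case True
            then show ?thesis
              using h by (simp add: degree_component_homogeneous[of _ ?d] comp_comp derivationD(1)[OF \<delta>])
          next
            case False
            then have "?d + k - e > k" using le[of e] e by simp
            then show ?thesis using top[of "?d + k - e" "C e ?h"] h False by simp
          qed
        qed
        also have "\<dots> = ?\<delta> (C ?d ?h)"
          using finite_support[OF h] derivation_zero[OF derivation_degree_component]
          by (auto simp: sum.delta)
        finally show ?thesis .
      qed
      ultimately show ?case
        using Suc by (simp add: algebra_simps)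
    qed
    then have power_eq: "(?\<delta> ^^ n) f = C (d + int n * k) ((\<delta> ^^ n) f)" for n
      by simp
    have "\<exists>n. d + int n * k \<notin> {e. \<exists>n. C e ((\<delta> ^^ n) f) \<noteq> 0}"
    proof (rule ccontr)
      assume "\<not> ?thesis"
      then have "range (\<lambda>n. d + int n * k) \<subseteq> {e. \<exists>n. C e ((\<delta> ^^ n) f) \<noteq> 0}" by blast
      moreover have "inj (\<lambda>n. d + int n * k)"
        using \<open>k > 0\<close> by (auto intro!: injI)
      ultimately show False
        using locally_finite[OF homogeneous(1)] finite_subset finite_imageD infinite_UNIV_nat by blast
    qed
    then show ?case
      using power_eq by auto
  next
    case (add f g)
    then obtain m n where mn: "(?\<delta> ^^ m) f = 0" "(?\<delta> ^^ n) g = 0" by blast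
    have "(?\<delta> ^^ (n + m)) f = 0" "(?\<delta> ^^ (m + n)) g = 0"
      using mn derivation_power(4)[OF derivation_degree_component]
      by (simp_all add: funpow_add)
    then have "(?\<delta> ^^ (m + n)) f = 0" "(?\<delta> ^^ (m + n)) g = 0"
      by (simp_all add: add.commute)
    then show ?case
      using add derivation_power(2)[OF derivation_degree_component] by (intro exI[of _ "m + n"]) simp
  qed
qed

text \<open>A component that is zero on the finitely many generators is zero, and each generator is moved by
  only finitely many components.\<close>

lemma finite_nonzero_degree_components:
  assumes "finite G" "G \<subseteq> A"
    and gen: "\<And>D. derivation D \<Longrightarrow> \<forall>g\<in>G. D g = 0 \<Longrightarrow> \<forall>f\<in>A. D f = 0"
  shows "finite {k. \<exists>f\<in>A. degree_component \<delta> k f \<noteq> 0}"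
proof (rule finite_subset)
  let ?K = "\<Union>g\<in>G. \<Union>d\<in>{d. C d g \<noteq> 0}. (\<lambda>e. e - d) ` {e. C e (\<delta> (C d g)) \<noteq> 0}"
  show "finite ?K"
    using assms(1,2) by (auto intro!: finite_support derivationD(1)[OF \<delta>] finite_UN_I finite_imageI)
  show "{k. \<exists>f\<in>A. degree_component \<delta> k f \<noteq> 0} \<subseteq> ?K"
  proof clarify
    fix k f assume "f \<in> A" "degree_component \<delta> k f \<noteq> 0"
    then obtain g where g: "g \<in> G" "degree_component \<delta> k g \<noteq> 0"
      using gen[OF derivation_degree_component] by blast
    then obtain d where "C d g \<noteq> 0" "C (d + k) (\<delta> (C d g)) \<noteq> 0"
      unfolding degree_component_def by (metis (mono_tags, lifting) mem_Collect_eq sum.neutral)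
    then show "k \<in> ?K"
      using g(1) by (auto intro!: bexI[of _ g] exI[of _ d] image_eqI[of _ _ "d + k"])
  qed
qed

lemma positive_degree_components_vanish:
  assumes "finite G" "G \<subseteq> A"
    and gen: "\<And>D. derivation D \<Longrightarrow> \<forall>g\<in>G. D g = 0 \<Longrightarrow> \<forall>f\<in>A. D f = 0"
    and no_lnd: "\<And>D. derivation D \<Longrightarrow> locally_nilpotent D \<Longrightarrow> \<forall>f\<in>A. D f = 0"
    and locally_finite: "\<And>f. f \<in> A \<Longrightarrow> finite {e. \<exists>n. C e ((\<delta> ^^ n) f) \<noteq> 0}"
    and "k > 0" "f \<in> A"
  shows "degree_component \<delta> k f = 0"
proof (rule ccontr)
  assume "degree_component \<delta> k f \<noteq> 0"
  define K where "K = {k. \<exists>f\<in>A. degree_component \<delta> k f \<noteq> 0}"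
  have fin: "finite K"
    unfolding K_def by (rule finite_nonzero_degree_components[OF assms(1-3)])
  have "k \<in> K"
    using \<open>degree_component \<delta> k f \<noteq> 0\<close> \<open>f \<in> A\<close> by (auto simp: K_def)
  then have "Max K > 0"
    using fin \<open>k > 0\<close> Max_ge[of K k] by linarith
  moreover have "degree_component \<delta> j h = 0" if "j > Max K" "h \<in> A" for j h
  proof -
    have "j \<notin> K"
      using that(1) Max_ge[OF fin] by (meson leD)
    then show ?thesis
      using that by (auto simp: K_def)
  qed
  ultimately have "locally_nilpotent (degree_component \<delta> (Max K))"
    by (intro top_degree_component_locally_nilpotent locally_finite)
  then have "\<forall>f\<in>A. degree_component \<delta> (Max K) f = 0"
    by (rule no_lnd[OF derivation_degree_component])
  moreover have "Max K \<in> K"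
    using fin \<open>k \<in> K\<close> by (auto intro: Max_in)
  ultimately show False by (auto simp: K_def)
qed

end

lemma grading_uminus: "grading A (\<lambda>w. C (- w))"
proof
  fix f assume f: "f \<in> A"
  have eq: "{w. C (- w) f \<noteq> 0} = uminus ` {w. C w f \<noteq> 0}"
    by (auto intro!: image_eqI[of _ _ "- w" for w])
  show "finite {w. C (- w) f \<noteq> 0}"
    unfolding eq using finite_support[OF f] by simp
  show "(\<Sum>w | C (- w) f \<noteq> 0. C (- w) f) = f"
    unfolding eq using sum_support[OF f] by (simp add: sum.reindex)
next
  fix f g u v assume "f \<in> A" "g \<in> A" "C (- u) f = f" "C (- v) g = g"
  then show "C (- (u + v)) (f * g) = f * g"
    using comp_mult[of f g "- u" "- v"] by simp
qed (auto simp: comp_add comp_scale comp_comp)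

text \<open>Without nonzero locally nilpotent derivations there is no component of positive degree, and none
  of negative degree because the grading can be reversed.\<close>

lemma locally_finite_derivation_preserves_degree:
  assumes \<delta>: "derivation \<delta>" and "finite G" "G \<subseteq> A"
    and gen: "\<And>D. derivation D \<Longrightarrow> \<forall>g\<in>G. D g = 0 \<Longrightarrow> \<forall>f\<in>A. D f = 0"
    and no_lnd: "\<And>D. derivation D \<Longrightarrow> locally_nilpotent D \<Longrightarrow> \<forall>f\<in>A. D f = 0"
    and locally_finite: "\<And>f. f \<in> A \<Longrightarrow> finite {e. \<exists>n. C e ((\<delta> ^^ n) f) \<noteq> 0}"
    and f: "f \<in> A"
  shows "C e (\<delta> f) = \<delta> (C e f)"
proof -
  interpret neg: grading A "\<lambda>w. C (- w)" by (rule grading_uminus)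
  have zero: "C v (\<delta> (C u f)) = 0" if "v \<noteq> u" "f \<in> A" for u v f
  proof (cases "v > u")
    case True
    then have "degree_component \<delta> (v - u) (C u f) = 0"
      using that by (intro positive_degree_components_vanish[OF \<delta> assms(2-6)]) auto
    then show ?thesis
      using that by (simp add: degree_component_homogeneous[OF \<delta>, of _ u] comp_comp)
  next
    case False
    have "finite {e. \<exists>n. C (- e) ((\<delta> ^^ n) f) \<noteq> 0}" if "f \<in> A" for f
    proof -
      have "{e. \<exists>n. C (- e) ((\<delta> ^^ n) f) \<noteq> 0} = uminus ` {e. \<exists>n. C e ((\<delta> ^^ n) f) \<noteq> 0}"
        by (auto intro!: image_eqI[of _ _ "- w" for w])
      then show ?thesis using locally_finite[OF that] by simp
    qed
    then have "neg.degree_component \<delta> (u - v) (C u f) = 0"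
      using False that by (intro neg.positive_degree_components_vanish[OF \<delta> assms(2-5)]) auto
    then show ?thesis
      using that by (simp add: neg.degree_component_homogeneous[OF \<delta>, of _ "- u"] comp_comp)
  qed
  show ?thesis
    using f
  proof (induction f rule: homogeneous_induct)
    case (homogeneous d f)
    have "C d (\<delta> f) = \<delta> f"
    proof (rule eq_if_comp_eq)
      fix v show "C v (C d (\<delta> f)) = C v (\<delta> f)"
        using zero[of v d f] homogeneous by (auto simp: comp_comp derivationD(1)[OF \<delta>])
    qed (use homogeneous in \<open>auto simp: derivationD(1)[OF \<delta>]\<close>)
    then show ?case
      using homogeneous comp_homogeneous[of f d e] comp_homogeneous[of "\<delta> f" d e]
      by (auto simp: derivationD(1)[OF \<delta>] derivation_zero[OF \<delta>])
  next
    case (add f g)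
    then show ?case by (simp add: comp_add derivationD[OF \<delta>])
  qed
qed

end

text \<open>The Euler derivation of \<open>C'\<close> is locally finite, because its powers on \<open>f\<close> stay in the span of the
  homogeneous parts of \<open>f\<close>. So it commutes with the projections \<open>C e\<close>, which therefore preserve its
  eigenspaces, that is, the homogeneous parts for \<open>C'\<close>.\<close>

theorem (in function_algebra) gradings_commute:
  assumes C: "grading A C" and C': "grading A C'" and "finite G" "G \<subseteq> A"
    and gen: "\<And>D. derivation D \<Longrightarrow> \<forall>g\<in>G. D g = 0 \<Longrightarrow> \<forall>f\<in>A. D f = 0"
    and no_lnd: "\<And>D. derivation D \<Longrightarrow> locally_nilpotent D \<Longrightarrow> \<forall>f\<in>A. D f = 0"
    and f: "f \<in> A"
  shows "C e (C' w f) = C' w (C e f)"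
proof -
  interpret C: grading A C by (rule C)
  interpret C': grading A C' by (rule C')
  have locally_finite: "finite {e. \<exists>n. C e ((C'.euler ^^ n) h) \<noteq> 0}" if "h \<in> A" for h
  proof (rule finite_subset)
    show "finite (\<Union>v\<in>{v. C' v h \<noteq> 0}. {e. C e (C' v h) \<noteq> 0})"
      using that by (auto intro!: finite_UN_I C.finite_support C'.finite_support)
    show "{e. \<exists>n. C e ((C'.euler ^^ n) h) \<noteq> 0} \<subseteq> (\<Union>v\<in>{v. C' v h \<noteq> 0}. {e. C e (C' v h) \<noteq> 0})"
    proof clarify
      fix e n assume "C e ((C'.euler ^^ n) h) \<noteq> 0"
      moreover have "C e ((C'.euler ^^ n) h) = (\<Sum>v | C' v h \<noteq> 0. (\<lambda>_. of_int v ^ n) * C e (C' v h))"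
        using that by (simp add: C'.euler_power C.comp_sum C.comp_scale)
      ultimately obtain v where "C' v h \<noteq> 0" "(\<lambda>_. of_int v ^ n) * C e (C' v h) \<noteq> 0"
        by (metis (mono_tags, lifting) mem_Collect_eq sum.neutral)
      then show "e \<in> (\<Union>v\<in>{v. C' v h \<noteq> 0}. {e. C e (C' v h) \<noteq> 0})" by auto
    qed
  qed
  have commutes: "C e (C'.euler h) = C'.euler (C e h)" if "h \<in> A" for h
    using that assms(3-6) locally_finite
    by (intro C.locally_finite_derivation_preserves_degree C'.derivation_euler)
  have homogeneous: "C' v (C e (C' v f)) = C e (C' v f)" for v
  proof (rule C'.euler_eigenvector)
    have "C'.euler (C e (C' v f)) = C e ((\<lambda>_. of_int v) * C' v f)"
      using f commutes[of "C' v f"] by (simp add: C'.euler_homogeneous[of _ v] C'.comp_comp)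
    then show "C'.euler (C e (C' v f)) = (\<lambda>_. of_int v) * C e (C' v f)"
      using f by (simp add: C.comp_scale)
  qed (use f in simp)
  have "C' w (C e f) = C' w (C e (\<Sum>v | C' v f \<noteq> 0. C' v f))"
    using C'.sum_support[OF f] by simp
  also have "\<dots> = (\<Sum>v | C' v f \<noteq> 0. C' w (C e (C' v f)))"
    using f by (simp add: C.comp_sum C'.comp_sum)
  also have "\<dots> = (\<Sum>v | C' v f \<noteq> 0. if v = w then C e (C' w f) else 0)"
    using C'.comp_homogeneous[OF _ homogeneous] f by (intro sum.cong) auto
  also have "\<dots> = C e (C' w f)"
    using C'.finite_support[OF f] by (auto simp: sum.delta)
  finally show ?thesis by simp
qed

section \<open>Polynomial maps and regular functions\<close>

definition monomial_value :: "('i \<Rightarrow> 'a::comm_semiring_1) \<Rightarrow> ('i \<Rightarrow>\<^sub>0 nat) \<Rightarrow> 'a"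
  where "monomial_value v m = (\<Prod>i\<in>Poly_Mapping.keys m. v i ^ Poly_Mapping.lookup m i)"

lemma monomial_value_superset:
  assumes "finite S" "Poly_Mapping.keys m \<subseteq> S"
  shows "monomial_value v m = (\<Prod>i\<in>S. v i ^ Poly_Mapping.lookup m i)"
  unfolding monomial_value_def using assms
  by (intro prod.mono_neutral_left) (auto simp: in_keys_iff)

lemma monomial_value_add: "monomial_value v (m + n) = monomial_value v m * monomial_value v n"
proof -
  let ?S = "Poly_Mapping.keys m \<union> Poly_Mapping.keys n"
  have "monomial_value v (m + n) = (\<Prod>i\<in>?S. v i ^ Poly_Mapping.lookup (m + n) i)"
    using keys_add[of m n] by (intro monomial_value_superset) auto
  also have "\<dots> = (\<Prod>i\<in>?S. v i ^ Poly_Mapping.lookup m i) * (\<Prod>i\<in>?S. v i ^ Poly_Mapping.lookup n i)"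
    by (simp add: lookup_add power_add prod.distrib)
  also have "\<dots> = monomial_value v m * monomial_value v n"
    by (simp add: monomial_value_superset[of ?S])
  finally show ?thesis .
qed

lemma mpoly_eval_superset:
  assumes "finite S" "Poly_Mapping.keys p \<subseteq> S"
  shows "mpoly_eval v p = (\<Sum>m\<in>S. Poly_Mapping.lookup p m * monomial_value v m)"
  unfolding mpoly_eval_def monomial_value_def[symmetric] using assms
  by (intro sum.mono_neutral_left) (auto simp: in_keys_iff)

lemma mpoly_eval_zero [simp]: "mpoly_eval v 0 = 0"
  by (simp add: mpoly_eval_def)

lemma mpoly_eval_single: "mpoly_eval v (Poly_Mapping.single m c) = c * monomial_value v m"
  by (subst mpoly_eval_superset[of "{m}"]) auto

lemma mpoly_eval_add: "mpoly_eval v (p + q) = mpoly_eval v p + mpoly_eval v q"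
proof -
  let ?S = "Poly_Mapping.keys p \<union> Poly_Mapping.keys q"
  have "mpoly_eval v (p + q) = (\<Sum>m\<in>?S. Poly_Mapping.lookup (p + q) m * monomial_value v m)"
    using keys_add[of p q] by (intro mpoly_eval_superset) auto
  then show ?thesis
    by (simp add: lookup_add distrib_right sum.distrib mpoly_eval_superset[of ?S])
qed

lemma mpoly_eval_sum: "mpoly_eval v (sum F I) = (\<Sum>i\<in>I. mpoly_eval v (F i))"
  by (induction I rule: infinite_finite_induct) (auto simp: mpoly_eval_add)

lemma sum_singles:
  "(\<Sum>m\<in>Poly_Mapping.keys p. Poly_Mapping.single m (Poly_Mapping.lookup p m)) = p"
  by (rule poly_mapping_eqI)
     (auto simp: lookup_sum lookup_single when_def in_keys_iff sum.delta)

lemma mpoly_eval_mult: "mpoly_eval v (p * q) = mpoly_eval v p * mpoly_eval v q"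
proof -
  have "p * q =
      (\<Sum>m\<in>Poly_Mapping.keys p. Poly_Mapping.single m (Poly_Mapping.lookup p m)) *
      (\<Sum>n\<in>Poly_Mapping.keys q. Poly_Mapping.single n (Poly_Mapping.lookup q n))"
    by (simp only: sum_singles)
  also have "\<dots> = (\<Sum>m\<in>Poly_Mapping.keys p. \<Sum>n\<in>Poly_Mapping.keys q.
      Poly_Mapping.single (m + n) (Poly_Mapping.lookup p m * Poly_Mapping.lookup q n))"
    by (simp add: sum_product mult_single)
  finally show ?thesis
    by (simp add: mpoly_eval_sum mpoly_eval_single monomial_value_add)
       (simp add: mpoly_eval_def monomial_value_def sum_product mult_ac)
qed

definition polynomial_map :: "(('i \<Rightarrow> 'a::comm_semiring_1) \<Rightarrow> 'a) \<Rightarrow> bool"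
  where "polynomial_map f \<longleftrightarrow> (\<exists>p. \<forall>v. f v = mpoly_eval v p)"

lemma polynomial_map_mpoly_eval: "polynomial_map (\<lambda>v. mpoly_eval v p)"
  by (auto simp: polynomial_map_def)

lemma polynomial_map_const: "polynomial_map (\<lambda>_. c)"
  unfolding polynomial_map_def
  by (intro exI[of _ "Poly_Mapping.single 0 c"]) (simp add: mpoly_eval_single monomial_value_def)

lemma polynomial_map_var: "polynomial_map (\<lambda>v. v i)"
  unfolding polynomial_map_def
  by (intro exI[of _ "Poly_Mapping.single (Poly_Mapping.single i 1) 1"])
     (simp add: mpoly_eval_single monomial_value_def)

lemma polynomial_map_add:
  "polynomial_map f \<Longrightarrow> polynomial_map g \<Longrightarrow> polynomial_map (\<lambda>v. f v + g v)"
  unfolding polynomial_map_def by (metis mpoly_eval_add)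

lemma polynomial_map_mult:
  "polynomial_map f \<Longrightarrow> polynomial_map g \<Longrightarrow> polynomial_map (\<lambda>v. f v * g v)"
  unfolding polynomial_map_def by (metis mpoly_eval_mult)

lemma polynomial_map_sum:
  "(\<And>i. i \<in> I \<Longrightarrow> polynomial_map (F i)) \<Longrightarrow> polynomial_map (\<lambda>v. \<Sum>i\<in>I. F i v)"
  by (induction I rule: infinite_finite_induct)
     (auto intro: polynomial_map_const polynomial_map_add)

lemma polynomial_map_power: "polynomial_map f \<Longrightarrow> polynomial_map (\<lambda>v. f v ^ n)"
  by (induction n) (auto intro: polynomial_map_const polynomial_map_mult)

text \<open>Together with the closure properties above, this replaces all manipulation of monomials and
  coefficients.\<close>

lemma polynomial_map_induct [consumes 1, case_names const var add mult]:
  assumes "polynomial_map f"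
    and const: "\<And>c. P (\<lambda>_. c)"
    and var: "\<And>i. P (\<lambda>v. v i)"
    and add: "\<And>f g. polynomial_map f \<Longrightarrow> polynomial_map g \<Longrightarrow> P f \<Longrightarrow> P g \<Longrightarrow> P (\<lambda>v. f v + g v)"
    and mult: "\<And>f g. polynomial_map f \<Longrightarrow> polynomial_map g \<Longrightarrow> P f \<Longrightarrow> P g \<Longrightarrow> P (\<lambda>v. f v * g v)"
  shows "P f"
proof -
  define Q where "Q f \<longleftrightarrow> polynomial_map f \<and> P f" for f
  have Q_const: "Q (\<lambda>_. c)" for c
    using polynomial_map_const const by (simp add: Q_def)
  have Q_var: "Q (\<lambda>v. v i)" for i
    using polynomial_map_var var by (simp add: Q_def)
  have Q_add: "Q (\<lambda>v. f v + g v)" if "Q f" "Q g" for f g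
    using that by (auto simp: Q_def intro: add polynomial_map_add)
  have Q_mult: "Q (\<lambda>v. f v * g v)" if "Q f" "Q g" for f g
    using that by (auto simp: Q_def intro: mult polynomial_map_mult)
  have Q_power: "Q (\<lambda>v. v i ^ n)" for i n
    by (induction n) (auto intro: Q_const Q_mult Q_var)
  have Q_prod: "Q (\<lambda>v. \<Prod>i\<in>I. v i ^ e i)" for I e
    by (induction I rule: infinite_finite_induct) (auto intro: Q_const Q_mult Q_power)
  have Q_sum: "Q (\<lambda>v. \<Sum>m\<in>M. c m * (\<Prod>i\<in>I m. v i ^ e m i))" for M :: "('i \<Rightarrow>\<^sub>0 nat) set" and c I e
  proof (induction M rule: infinite_finite_induct)
    case (insert m M)
    then show ?case
      using Q_add[OF Q_mult[OF Q_const Q_prod] insert.IH] by simp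
  qed (simp_all add: Q_const)
  obtain p where p: "\<And>v. f v = mpoly_eval v p"
    using assms(1) by (auto simp: polynomial_map_def)
  then have "f = (\<lambda>v. \<Sum>m\<in>Poly_Mapping.keys p. Poly_Mapping.lookup p m *
      (\<Prod>i\<in>Poly_Mapping.keys m. v i ^ Poly_Mapping.lookup m i))"
    by (simp add: fun_eq_iff mpoly_eval_def)
  then have "Q f"
    using Q_sum by (simp only:)
  then show ?thesis
    by (simp add: Q_def)
qed

lemma polynomial_map_compose:
  assumes "polynomial_map f" "\<And>i. polynomial_map (h i)"
  shows "polynomial_map (\<lambda>v. f (\<lambda>i. h i v))"
  using assms(1)
  by (induction f rule: polynomial_map_induct)
     (auto intro: assms(2) polynomial_map_const polynomial_map_add polynomial_map_mult)

lemma polynomial_map_familyE: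
  assumes "\<And>i. polynomial_map (F i)"
  obtains p where "\<And>i. F i = (\<lambda>v. mpoly_eval v (p i))"
proof -
  have "\<forall>i. \<exists>p. F i = (\<lambda>v. mpoly_eval v p)"
    using assms by (auto simp: polynomial_map_def fun_eq_iff)
  then show ?thesis
    using that by (metis choice)
qed

lemma affine_morphism_iff:
  "affine_morphism X Y f \<longleftrightarrow> f \<in> X \<rightarrow> Y \<and>
    (\<exists>F. \<forall>i. polynomial_map (F i) \<and> (\<forall>x\<in>X. f x $ i = F i (($) x)))"
proof (intro iffI conjI)
  assume *: "affine_morphism X Y f"
  then show "f \<in> X \<rightarrow> Y" by (simp add: affine_morphism_def)
  obtain p where "\<forall>x\<in>X. \<forall>i. f x $ i = mpoly_eval (($) x) (p i)"
    using * by (auto simp: affine_morphism_def)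
  then show "\<exists>F. \<forall>i. polynomial_map (F i) \<and> (\<forall>x\<in>X. f x $ i = F i (($) x))"
    by (intro exI[of _ "\<lambda>i v. mpoly_eval v (p i)"]) (auto intro: polynomial_map_mpoly_eval)
next
  assume *: "f \<in> X \<rightarrow> Y \<and>
    (\<exists>F. \<forall>i. polynomial_map (F i) \<and> (\<forall>x\<in>X. f x $ i = F i (($) x)))"
  then obtain F where F: "\<And>i. polynomial_map (F i)" "\<And>x i. x \<in> X \<Longrightarrow> f x $ i = F i (($) x)"
    by blast
  obtain p where "\<And>i. F i = (\<lambda>v. mpoly_eval v (p i))"
    using polynomial_map_familyE[of F] F(1) by blast
  then show "affine_morphism X Y f"
    unfolding affine_morphism_def using * F(2) by (auto intro!: exI[of _ p])
qed

lemma action_morphism_iff: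
  "action_morphism G c X \<alpha> \<longleftrightarrow>
    (\<exists>F. \<forall>i. polynomial_map (F i) \<and> (\<forall>g\<in>G. \<forall>x\<in>X. \<alpha> g x $ i = F i (case_sum (c g) (($) x))))"
proof
  assume "action_morphism G c X \<alpha>"
  then obtain p where "\<forall>g\<in>G. \<forall>x\<in>X. \<forall>i. \<alpha> g x $ i = mpoly_eval (case_sum (c g) (($) x)) (p i)"
    by (auto simp: action_morphism_def)
  then show "\<exists>F. \<forall>i. polynomial_map (F i) \<and>
      (\<forall>g\<in>G. \<forall>x\<in>X. \<alpha> g x $ i = F i (case_sum (c g) (($) x)))"
    by (intro exI[of _ "\<lambda>i v. mpoly_eval v (p i)"]) (auto intro: polynomial_map_mpoly_eval)
next
  assume "\<exists>F. \<forall>i. polynomial_map (F i) \<and>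
      (\<forall>g\<in>G. \<forall>x\<in>X. \<alpha> g x $ i = F i (case_sum (c g) (($) x)))"
  then obtain F where F: "\<And>i. polynomial_map (F i)"
      "\<And>g x i. g \<in> G \<Longrightarrow> x \<in> X \<Longrightarrow> \<alpha> g x $ i = F i (case_sum (c g) (($) x))"
    by blast
  obtain p where "\<And>i. F i = (\<lambda>v. mpoly_eval v (p i))"
    using polynomial_map_familyE[of F] F(1) by blast
  then show "action_morphism G c X \<alpha>"
    unfolding action_morphism_def using F(2) by (auto intro!: exI[of _ p])
qed

text \<open>Regular functions on \<open>X\<close> are represented by functions on the whole space that vanish outside \<open>X\<close>.
  In this way they form a set of functions in which equality on \<open>X\<close> is equality.\<close>

definition restrict0 :: "'x set \<Rightarrow> ('x \<Rightarrow> 'a::zero) \<Rightarrow> 'x \<Rightarrow> 'a"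
  where "restrict0 X f = (\<lambda>x. if x \<in> X then f x else 0)"

definition regular_functions :: "('a::field ^ 'n) set \<Rightarrow> ('a ^ 'n \<Rightarrow> 'a) set"
  where "regular_functions X = {restrict0 X (\<lambda>x. F (($) x)) | F. polynomial_map F}"

definition coordinate :: "('a::field ^ 'n) set \<Rightarrow> 'n \<Rightarrow> 'a ^ 'n \<Rightarrow> 'a"
  where "coordinate X i = restrict0 X (\<lambda>x. x $ i)"

lemma regular_functionsI: "polynomial_map F \<Longrightarrow> restrict0 X (\<lambda>x. F (($) x)) \<in> regular_functions X"
  by (auto simp: regular_functions_def)

lemma regular_functionsE:
  assumes "f \<in> regular_functions X"
  obtains F where "polynomial_map F" "\<And>x. x \<in> X \<Longrightarrow> f x = F (($) x)" "\<And>x. x \<notin> X \<Longrightarrow> f x = 0"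
  using assms by (auto simp: regular_functions_def restrict0_def)

lemma regular_functions_eqI:
  assumes "f \<in> regular_functions X" "g \<in> regular_functions X" "\<And>x. x \<in> X \<Longrightarrow> f x = g x"
  shows "f = g"
proof
  fix x show "f x = g x"
    using assms by (cases "x \<in> X") (auto elim!: regular_functionsE)
qed

lemma coordinate_regular [simp]: "coordinate X i \<in> regular_functions X"
  unfolding coordinate_def using regular_functionsI[OF polynomial_map_var] .

lemma coordinate_apply: "x \<in> X \<Longrightarrow> coordinate X i x = x $ i"
  by (simp add: coordinate_def restrict0_def)

lemma const_regular [simp]: "restrict0 X (\<lambda>_. c) \<in> regular_functions X"
  using regular_functionsI[OF polynomial_map_const] .

lemma restrict0_add: "restrict0 X (\<lambda>x. f x + g x) = restrict0 X f + restrict0 X (g :: _ \<Rightarrow> 'a::monoid_add)"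
  by (auto simp: restrict0_def fun_eq_iff pointwise)

lemma restrict0_mult: "restrict0 X (\<lambda>x. f x * g x) = restrict0 X f * restrict0 X (g :: _ \<Rightarrow> 'a::mult_zero)"
  by (auto simp: restrict0_def fun_eq_iff pointwise)

lemma function_algebra_regular_functions:
  "function_algebra (regular_functions X :: ('a::field_char_0 ^ 'n \<Rightarrow> 'a) set)"
proof
  show "0 \<in> regular_functions X"
    using const_regular[of X 0] by (simp add: restrict0_def zero_fun_def)
  fix f g :: "'a ^ 'n \<Rightarrow> 'a" assume f: "f \<in> regular_functions X"
  then obtain F where F: "polynomial_map F" "f = restrict0 X (\<lambda>x. F (($) x))"
    by (auto simp: regular_functions_def)
  show "(\<lambda>_. c) * f \<in> regular_functions X" for c
  proof -
    have "(\<lambda>_. c) * f = restrict0 X (\<lambda>x. c * F (($) x))"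
      using F by (auto simp: restrict0_def fun_eq_iff pointwise)
    then show ?thesis
      using regular_functionsI[OF polynomial_map_mult[OF polynomial_map_const F(1)]] by simp
  qed
  assume "g \<in> regular_functions X"
  then obtain G where G: "polynomial_map G" "g = restrict0 X (\<lambda>x. G (($) x))"
    by (auto simp: regular_functions_def)
  show "f + g \<in> regular_functions X" "f * g \<in> regular_functions X"
    unfolding F G restrict0_add[symmetric] restrict0_mult[symmetric]
    using regular_functionsI[OF polynomial_map_add[OF F(1) G(1)]]
      regular_functionsI[OF polynomial_map_mult[OF F(1) G(1)]] by simp_all
qed

lemma regular_functions_induct [consumes 1, case_names const coordinate add mult]:
  assumes "f \<in> regular_functions X"
    and const: "\<And>c. P (restrict0 X (\<lambda>_. c))"
    and coordinate: "\<And>i. P (coordinate X i)"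
    and add: "\<And>f g. f \<in> regular_functions X \<Longrightarrow> g \<in> regular_functions X \<Longrightarrow> P f \<Longrightarrow> P g \<Longrightarrow> P (f + g)"
    and mult: "\<And>f g. f \<in> regular_functions X \<Longrightarrow> g \<in> regular_functions X \<Longrightarrow> P f \<Longrightarrow> P g \<Longrightarrow> P (f * g)"
  shows "P f"
proof -
  have "P (restrict0 X (\<lambda>x. F (($) x)))" if "polynomial_map F" for F
    using that
  proof (induction F rule: polynomial_map_induct)
    case (var i)
    then show ?case using coordinate by (simp add: coordinate_def)
  qed (auto simp: restrict0_add restrict0_mult intro: const add mult regular_functionsI)
  then show ?thesis
    using assms(1) by (auto simp: regular_functions_def)
qed

text \<open>The unit satisfies \<open>1 * 1 = 1\<close>, hence \<open>D 1 = 2 * D 1\<close>.\<close>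

lemma derivation_regular_const:
  fixes X :: "('a::field_char_0 ^ 'n) set"
  assumes "function_algebra.derivation (regular_functions X) D"
  shows "D (restrict0 X (\<lambda>_. c)) = 0"
proof -
  interpret function_algebra "regular_functions X" by (rule function_algebra_regular_functions)
  note D = derivationD[OF assms]
  let ?one = "restrict0 X (\<lambda>_. 1 :: 'a)"
  have one: "D ?one = 0"
  proof (rule regular_functions_eqI)
    fix x assume x: "x \<in> X"
    have "?one * ?one = ?one"
      by (simp add: restrict0_mult[symmetric])
    then have "D ?one = ?one * D ?one + ?one * D ?one"
      using D(4)[of ?one ?one] by simp
    then have "D ?one x = (?one * D ?one + ?one * D ?one) x"
      by (rule arg_cong)
    then have "D ?one x = D ?one x + D ?one x"
      using x by (simp only: pointwise) (simp add: restrict0_def)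
    then show "D ?one x = 0 x"
      by (simp add: pointwise)
  qed (simp_all add: D)
  have "restrict0 X (\<lambda>_. c) = (\<lambda>_. c) * ?one"
    by (auto simp: restrict0_def fun_eq_iff pointwise)
  then show ?thesis
    using D(3)[of ?one c] by (simp add: one)
qed

lemma derivation_regular_eq_zero:
  fixes X :: "('a::field_char_0 ^ 'n) set"
  assumes "function_algebra.derivation (regular_functions X) D"
    and zero: "\<And>i. D (coordinate X i) = 0"
    and "f \<in> regular_functions X"
  shows "D f = 0"
proof -
  interpret function_algebra "regular_functions X" by (rule function_algebra_regular_functions)
  show ?thesis
    using assms(3)
    by (induction f rule: regular_functions_induct)
       (auto simp: derivationD[OF assms(1)] derivation_regular_const[OF assms(1)] zero)
qed

section \<open>Exponentials of locally nilpotent derivations\<close>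

lemma group_Ga: "group (Ga :: 'a::field monoid)"
  by (rule groupI) (auto simp: Ga_def add.assoc intro: exI[of _ "- x" for x :: 'a])

lemma coeff_Suc_eq_pderiv:
  "coeff (p :: 'a::field_char_0 poly) (Suc n) = coeff (pderiv p) n / of_nat (Suc n)"
proof -
  have "(of_nat (Suc n) :: 'a) \<noteq> 0"
    by (simp only: of_nat_eq_0_iff)
  then show ?thesis
    by (simp add: coeff_pderiv del: of_nat_Suc)
qed

text \<open>The flow of a locally nilpotent derivation \<open>\<delta>\<close>: the algebra automorphism \<open>exp (s \<delta>)\<close> of the coordinate
  ring is composition with a map \<open>flow s\<close> of \<open>X\<close>, and these maps form an action of the additive group.\<close>

locale locally_nilpotent_derivation =
  fixes X :: "('a::field_char_0 ^ 'n) set" and \<delta> :: "('a ^ 'n \<Rightarrow> 'a) \<Rightarrow> ('a ^ 'n \<Rightarrow> 'a)"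
  assumes derivation: "function_algebra.derivation (regular_functions X) \<delta>"
    and nilpotent: "function_algebra.locally_nilpotent (regular_functions X) \<delta>"
    and closed: "affine_closed X"
begin

sublocale function_algebra "regular_functions X"
  by (rule function_algebra_regular_functions)

lemmas \<delta> = derivationD[OF derivation]
lemmas \<delta>_power = derivation_power[OF derivation]

text \<open>The value of \<open>exp (s \<delta>) f\<close> at \<open>x\<close>, as a polynomial in \<open>s\<close>.\<close>

definition exp_series :: "('a ^ 'n \<Rightarrow> 'a) \<Rightarrow> 'a ^ 'n \<Rightarrow> 'a poly"
  where "exp_series f x = Abs_poly (\<lambda>n. (\<delta> ^^ n) f x / fact n)"

lemma eventually_zero:
  assumes "f \<in> regular_functions X"
  obtains N where "\<And>n. n \<ge> N \<Longrightarrow> (\<delta> ^^ n) f = 0"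
proof -
  obtain N where N: "(\<delta> ^^ N) f = 0"
    using nilpotent assms by (auto simp: locally_nilpotent_def)
  have "(\<delta> ^^ n) f = 0" if "n \<ge> N" for n
  proof -
    have "(\<delta> ^^ n) f = (\<delta> ^^ (n - N)) ((\<delta> ^^ N) f)"
      using that by (metis funpow_add le_add_diff_inverse2 o_apply)
    then show ?thesis by (simp add: N \<delta>_power(4))
  qed
  then show ?thesis using that by blast
qed

lemma coeff_exp_series:
  assumes "f \<in> regular_functions X"
  shows "coeff (exp_series f x) n = (\<delta> ^^ n) f x / fact n"
proof -
  obtain N where "\<And>n. n \<ge> N \<Longrightarrow> (\<delta> ^^ n) f = 0"
    using eventually_zero[OF assms] by blast
  then have "coeff (Abs_poly (\<lambda>n. (\<delta> ^^ n) f x / fact n)) = (\<lambda>n. (\<delta> ^^ n) f x / fact n)"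
    by (intro coeff_Abs_poly[where n = N]) (simp add: zero_fun_apply)
  then show ?thesis
    by (simp add: exp_series_def)
qed

lemma coeff_0_exp_series: "f \<in> regular_functions X \<Longrightarrow> coeff (exp_series f x) 0 = f x"
  by (simp add: coeff_exp_series)

lemma poly_0_exp_series: "f \<in> regular_functions X \<Longrightarrow> poly (exp_series f x) 0 = f x"
  by (simp add: poly_0_coeff_0 coeff_0_exp_series)

lemma exp_series_zero: "exp_series 0 x = 0"
  by (rule poly_eqI) (simp add: coeff_exp_series \<delta>_power zero_fun_apply)

lemma exp_series_add:
  "f \<in> regular_functions X \<Longrightarrow> g \<in> regular_functions X \<Longrightarrow>
    exp_series (f + g) x = exp_series f x + exp_series g x"
  by (rule poly_eqI) (simp add: coeff_exp_series \<delta>_power pointwise add_divide_distrib)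

lemma pderiv_exp_series:
  assumes "f \<in> regular_functions X"
  shows "pderiv (exp_series f x) = exp_series (\<delta> f) x"
proof (rule poly_eqI)
  fix n
  have "coeff (pderiv (exp_series f x)) n = of_nat (Suc n) * ((\<delta> ^^ Suc n) f x / fact (Suc n))"
    using assms by (simp only: coeff_pderiv coeff_exp_series)
  also have "\<dots> = (\<delta> ^^ Suc n) f x / fact n"
    by (simp add: field_simps del: of_nat_Suc funpow.simps)
  also have "\<dots> = coeff (exp_series (\<delta> f) x) n"
    using assms by (simp add: coeff_exp_series \<delta> funpow_Suc_right del: funpow.simps)
  finally show "coeff (pderiv (exp_series f x)) n = coeff (exp_series (\<delta> f) x) n" .
qed

text \<open>Both sides have the same constant term, and by the product rules for \<open>\<delta>\<close> and for polynomials their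
  derivatives are the sums of the two sides for the pairs \<open>(f, \<delta> g)\<close> and \<open>(g, \<delta> f)\<close>. So the coefficients agree by
  induction, simultaneously for all \<open>f\<close> and \<open>g\<close>.\<close>

lemma exp_series_mult:
  assumes "f \<in> regular_functions X" "g \<in> regular_functions X"
  shows "exp_series (f * g) x = exp_series f x * exp_series g x"
proof (rule poly_eqI)
  fix n
  show "coeff (exp_series (f * g) x) n = coeff (exp_series f x * exp_series g x) n"
    using assms
  proof (induction n arbitrary: f g)
    case 0
    then show ?case
      by (simp add: coeff_0_exp_series coeff_mult_0) (simp add: pointwise)
  next
    case (Suc n)
    have "coeff (pderiv (exp_series (f * g) x)) n =
        coeff (pderiv (exp_series f x * exp_series g x)) n"
      using Suc by (simp add: pderiv_exp_series pderiv_mult exp_series_add \<delta>)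
    then show ?case
      by (simp only: coeff_Suc_eq_pderiv)
  qed
qed

definition flow :: "'a \<Rightarrow> 'a ^ 'n \<Rightarrow> 'a ^ 'n"
  where "flow s x = (\<chi> i. poly (exp_series (coordinate X i) x) s)"

text \<open>Both sides are multiplicative and additive in \<open>F\<close>, and they agree on the coordinates by the
  definition of the flow.\<close>

lemma polynomial_map_flow:
  assumes "polynomial_map F" "x \<in> X"
  shows "F (($) (flow s x)) = poly (exp_series (restrict0 X (\<lambda>x. F (($) x))) x) s"
  using assms(1)
proof (induction F rule: polynomial_map_induct)
  case (const c)
  have "(\<delta> ^^ n) (restrict0 X (\<lambda>_. c)) x = (if n = 0 then c else 0)" for n
  proof (cases n)
    case (Suc k)
    have "\<delta> (restrict0 X (\<lambda>_. c)) = 0"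
      by (rule derivation_regular_const[OF derivation])
    then show ?thesis
      unfolding Suc funpow_Suc_right o_apply by (simp add: \<delta>_power zero_fun_apply)
  qed (use assms in \<open>simp add: restrict0_def\<close>)
  then have "exp_series (restrict0 X (\<lambda>_. c)) x = [:c:]"
    by (intro poly_eqI) (simp add: coeff_exp_series coeff_pCons split: nat.split)
  then show ?case by simp
next
  case (var i)
  then show ?case by (simp add: flow_def coordinate_def)
next
  case (add f g)
  then show ?case
    by (simp add: restrict0_add exp_series_add regular_functionsI)
next
  case (mult f g)
  then show ?case
    by (simp add: restrict0_mult exp_series_mult regular_functionsI)
qed

text \<open>An equation of \<open>X\<close> is the zero element of the coordinate ring, so its exponential is zero.\<close>

lemma flow_closed:
  assumes "x \<in> X"
  shows "flow s x \<in> X"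
proof -
  obtain P where P: "X = {x. \<forall>p\<in>P. mpoly_eval (($) x) p = 0}"
    using closed by (auto simp: affine_closed_def)
  have "mpoly_eval (($) (flow s x)) p = 0" if "p \<in> P" for p
  proof -
    have "restrict0 X (\<lambda>x. mpoly_eval (($) x) p) = 0"
      using that P by (auto simp: restrict0_def fun_eq_iff pointwise)
    then show ?thesis
      using polynomial_map_flow[OF polynomial_map_mpoly_eval assms, of s p]
      by (simp add: exp_series_zero)
  qed
  then show ?thesis
    using P by blast
qed

lemma regular_flow:
  assumes "f \<in> regular_functions X" "x \<in> X"
  shows "f (flow s x) = poly (exp_series f x) s"
proof -
  obtain F where "polynomial_map F" "f = restrict0 X (\<lambda>x. F (($) x))"
    using assms(1) by (auto simp: regular_functions_def)
  then show ?thesis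
    using polynomial_map_flow[of F x s] assms(2) flow_closed[of x s] by (simp add: restrict0_def)
qed

text \<open>The group law of the flow. As polynomials in \<open>s\<close> both sides have the same value at \<open>0\<close>, and
  differentiation replaces \<open>f\<close> by \<open>\<delta> f\<close> on both sides.\<close>

lemma exp_series_flow:
  assumes "f \<in> regular_functions X" "x \<in> X"
  shows "exp_series f (flow t x) = pcompose (exp_series f x) [:t, 1:]"
proof (rule poly_eqI)
  fix n
  show "coeff (exp_series f (flow t x)) n = coeff (pcompose (exp_series f x) [:t, 1:]) n"
    using assms(1)
  proof (induction n arbitrary: f)
    case 0
    then show ?case
      using assms(2) by (simp add: poly_0_coeff_0[symmetric] poly_0_exp_series regular_flow poly_pcompose)
  next
    case (Suc n)
    have "coeff (pderiv (exp_series f (flow t x))) n =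
        coeff (pderiv (pcompose (exp_series f x) [:t, 1:])) n"
      using Suc by (simp add: pderiv_exp_series pderiv_pcompose \<delta> pderiv_pCons)
    then show ?case
      by (simp only: coeff_Suc_eq_pderiv)
  qed
qed

lemma flow_add:
  assumes "x \<in> X"
  shows "flow (s + t) x = flow s (flow t x)"
  unfolding flow_def[of s] flow_def[of "s + t"] exp_series_flow[OF coordinate_regular assms]
  by (simp add: poly_pcompose add.commute)

lemma flow_zero: "x \<in> X \<Longrightarrow> flow 0 x = x"
  by (simp add: flow_def vec_eq_iff poly_0_exp_series coordinate_apply)

lemma action_morphism_flow: "action_morphism UNIV (\<lambda>s (_ :: unit). s) X (\<lambda>s. restrict (flow s) X)"
  unfolding action_morphism_iff
proof -
  have "\<exists>F. polynomial_map F \<and> (\<forall>s. \<forall>x\<in>X. flow s x $ i = F (case_sum (\<lambda>_ :: unit. s) (($) x)))" for i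
  proof -
    obtain N where N: "\<And>n. n \<ge> N \<Longrightarrow> (\<delta> ^^ n) (coordinate X i) = 0"
      using eventually_zero[OF coordinate_regular] by blast
    have "\<forall>n. \<exists>P. polynomial_map P \<and> (\<forall>x\<in>X. (\<delta> ^^ n) (coordinate X i) x = P (($) x))"
      using \<delta>_power(1)[OF coordinate_regular] by (meson regular_functionsE)
    then obtain P where P: "\<And>n. polynomial_map (P n)"
        "\<And>n x. x \<in> X \<Longrightarrow> (\<delta> ^^ n) (coordinate X i) x = P n (($) x)"
      by metis
    let ?F = "\<lambda>v :: unit + 'n \<Rightarrow> 'a.
      \<Sum>n<N. (1 / fact n * P n (\<lambda>i. v (Inr i))) * v (Inl ()) ^ n"
    have "polynomial_map ?F"
      by (intro polynomial_map_sum polynomial_map_mult polynomial_map_power polynomial_map_const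
          polynomial_map_var polynomial_map_compose[OF P(1)])
    moreover have "flow s x $ i = ?F (case_sum (\<lambda>_. s) (($) x))" if "x \<in> X" for s x
    proof -
      let ?p = "exp_series (coordinate X i) x"
      have coeff: "coeff ?p n = (\<delta> ^^ n) (coordinate X i) x / fact n" for n
        by (simp add: coeff_exp_series)
      have "flow s x $ i = (\<Sum>n\<le>degree ?p. coeff ?p n * s ^ n)"
        by (simp add: flow_def poly_altdef)
      also have "\<dots> = (\<Sum>n<N. coeff ?p n * s ^ n)"
      proof (rule sum.mono_neutral_cong)
        fix n assume "n \<in> {..degree ?p} - {..<N}"
        then show "coeff ?p n * s ^ n = 0"
          by (simp add: coeff N zero_fun_apply)
      qed (auto simp: coeff_eq_0)
      also have "\<dots> = ?F (case_sum (\<lambda>_. s) (($) x))"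
        using that by (simp add: coeff P(2))
      finally show ?thesis .
    qed
    ultimately show ?thesis by blast
  qed
  then show "\<exists>F. \<forall>i. polynomial_map (F i) \<and>
      (\<forall>s\<in>UNIV. \<forall>x\<in>X. restrict (flow s) X x $ i = F i (case_sum (\<lambda>_ :: unit. s) (($) x)))"
    by simp metis
qed

lemma Ga_action_flow: "Ga_action X (\<lambda>s. restrict (flow s) X)"
  unfolding Ga_action_def
proof
  have "restrict (flow s) X \<in> Bij X" for s
  proof -
    have "bij_betw (flow s) X X"
      by (rule bij_betw_byWitness[of _ "flow (- s)"])
         (auto simp: flow_closed flow_zero flow_add[symmetric])
    then show ?thesis
      by (simp add: Bij_def)
  qed
  moreover have "restrict (flow (s + t)) X = compose X (restrict (flow s) X) (restrict (flow t) X)" for s t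
    by (auto simp: compose_def fun_eq_iff flow_add flow_closed)
  ultimately show "group_action Ga X (\<lambda>s. restrict (flow s) X)"
    using group_Ga by (auto intro!: group_action.intro group_hom.intro group_hom_axioms.intro homI group_BijGroup
        simp: Ga_def BijGroup_def)
qed (rule action_morphism_flow)

text \<open>If the flow is trivial, the exponential of each coordinate is constant in \<open>s\<close>, and its linear
  coefficient is the value of \<open>\<delta>\<close> on this coordinate.\<close>

lemma eq_zero_if_rigid:
  assumes "rigid X" "f \<in> regular_functions X"
  shows "\<delta> f = 0"
proof (rule derivation_regular_eq_zero[OF derivation _ assms(2)])
  fix i
  show "\<delta> (coordinate X i) = 0"
  proof (rule regular_functions_eqI)
    fix x assume x: "x \<in> X"
    have "poly (exp_series (coordinate X i) x) s = poly [:x $ i:] s" for s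
      using assms(1) Ga_action_flow x
      by (force simp: rigid_def flow_def vec_eq_iff restrict_def)
    then have "exp_series (coordinate X i) x = [:x $ i:]"
      by (intro poly_eq_poly_eq_iff[THEN iffD1]) auto
    then have "coeff (exp_series (coordinate X i) x) 1 = 0"
      by simp
    then show "\<delta> (coordinate X i) x = 0 x"
      by (simp add: coeff_exp_series zero_fun_apply)
  qed (auto simp: \<delta>)
qed

end

section \<open>The automorphism group of an affine variety\<close>

lemma affine_morphism_cong:
  "(\<And>x. x \<in> X \<Longrightarrow> f x = g x) \<Longrightarrow> affine_morphism X Y f \<longleftrightarrow> affine_morphism X Y g"
  by (auto simp: affine_morphism_def Pi_iff)

lemma affine_morphism_id: "affine_morphism X X (\<lambda>x. x)"
  unfolding affine_morphism_iff
  by (auto intro!: exI[of _ "\<lambda>i v. v i"] polynomial_map_var)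

lemma affine_morphism_compose:
  assumes "affine_morphism X Y f" "affine_morphism Y W g"
  shows "affine_morphism X W (\<lambda>x. g (f x))"
proof -
  obtain F where F: "\<And>i. polynomial_map (F i)" "\<And>x i. x \<in> X \<Longrightarrow> f x $ i = F i (($) x)"
    using assms(1) by (auto simp: affine_morphism_iff)
  obtain G where G: "\<And>i. polynomial_map (G i)" "\<And>y i. y \<in> Y \<Longrightarrow> g y $ i = G i (($) y)"
    using assms(2) by (auto simp: affine_morphism_iff)
  have XY: "f x \<in> Y" if "x \<in> X" for x
    using assms(1) that by (auto simp: affine_morphism_iff)
  have "($) (f x) = (\<lambda>j. F j (($) x))" if "x \<in> X" for x
    using F(2) that by auto
  then have "\<forall>x\<in>X. g (f x) $ i = G i (\<lambda>j. F j (($) x))" for i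
    using G(2) XY by auto
  moreover have "polynomial_map (\<lambda>v. G i (\<lambda>j. F j v))" for i
    by (rule polynomial_map_compose[OF G(1) F(1)])
  moreover have "(\<lambda>x. g (f x)) \<in> X \<rightarrow> W"
    using assms XY by (auto simp: affine_morphism_iff)
  ultimately show ?thesis
    unfolding affine_morphism_iff by (auto intro!: exI[of _ "\<lambda>i v. G i (\<lambda>j. F j v)"])
qed

lemma mem_aut_group_iff:
  "f \<in> carrier (aut_group X) \<longleftrightarrow>
    f \<in> Bij X \<and> affine_morphism X X f \<and> affine_morphism X X (inv\<^bsub>BijGroup X\<^esub> f)"
proof -
  have "affine_morphism X X (inv\<^bsub>BijGroup X\<^esub> f) \<longleftrightarrow> affine_morphism X X (inv_into X f)" if "f \<in> Bij X"
    by (rule affine_morphism_cong) (simp add: inv_BijGroup[OF that])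
  then show ?thesis
    by (auto simp: aut_group_def)
qed

lemma mult_BijGroup: "f \<in> Bij S \<Longrightarrow> g \<in> Bij S \<Longrightarrow> f \<otimes>\<^bsub>BijGroup S\<^esub> g = compose S f g"
  by (simp add: BijGroup_def)

lemma subgroup_aut_group:
  fixes X :: "('a::field ^ 'n) set"
  shows "subgroup (carrier (aut_group X)) (BijGroup X)"
proof -
  interpret B: group "BijGroup X" by (rule group_BijGroup)
  have carrier: "carrier (BijGroup X) = Bij X" by (simp add: BijGroup_def)
  have compose: "affine_morphism X X (compose X f g)"
    if "affine_morphism X X f" "affine_morphism X X g" for f g :: "'a ^ 'n \<Rightarrow> 'a ^ 'n"
    using affine_morphism_compose[OF that(2,1)]
    by (subst affine_morphism_cong[where g = "\<lambda>x. f (g x)"]) (auto simp: compose_def)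
  show ?thesis
  proof (rule B.subgroupI)
    show "carrier (aut_group X) \<subseteq> carrier (BijGroup X)"
      by (auto simp: carrier mem_aut_group_iff)
    have "affine_morphism X X \<one>\<^bsub>BijGroup X\<^esub>"
      using affine_morphism_id[of X]
      by (subst affine_morphism_cong[where g = "\<lambda>x. x"]) (auto simp: BijGroup_def)
    then have "\<one>\<^bsub>BijGroup X\<^esub> \<in> carrier (aut_group X)"
      using B.one_closed by (simp add: mem_aut_group_iff carrier)
    then show "carrier (aut_group X) \<noteq> {}" by blast
  next
    fix f assume f: "f \<in> carrier (aut_group X)"
    then show "inv\<^bsub>BijGroup X\<^esub> f \<in> carrier (aut_group X)"
      using B.inv_closed[of f] B.inv_inv[of f] by (auto simp: mem_aut_group_iff carrier)
    fix g assume g: "g \<in> carrier (aut_group X)"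
    have "f \<in> Bij X" "g \<in> Bij X" using f g by (auto simp: mem_aut_group_iff)
    moreover have "inv\<^bsub>BijGroup X\<^esub> f \<in> Bij X" "inv\<^bsub>BijGroup X\<^esub> g \<in> Bij X"
      using calculation B.inv_closed by (auto simp: carrier)
    ultimately show "f \<otimes>\<^bsub>BijGroup X\<^esub> g \<in> carrier (aut_group X)"
      using f g B.inv_mult_group[of f g] compose
      by (simp add: mem_aut_group_iff carrier mult_BijGroup compose_Bij)
  qed
qed

lemma aut_group_eq: "aut_group X = BijGroup X \<lparr>carrier := carrier (aut_group X)\<rparr>"
  by (simp add: aut_group_def)

lemma group_aut_group: "group (aut_group X)"
  using subgroup.subgroup_is_group[OF subgroup_aut_group group_BijGroup] aut_group_eq by metis

lemma aut_group_mult: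
  assumes "f \<in> carrier (aut_group X)" "g \<in> carrier (aut_group X)"
  shows "f \<otimes>\<^bsub>aut_group X\<^esub> g = compose X f g"
  using assms by (simp add: aut_group_def BijGroup_def)

lemma aut_group_mult_apply:
  assumes "f \<in> carrier (aut_group X)" "g \<in> carrier (aut_group X)" "x \<in> X"
  shows "(f \<otimes>\<^bsub>aut_group X\<^esub> g) x = f (g x)"
  using assms by (simp add: aut_group_mult compose_eq)

lemma aut_group_one: "\<one>\<^bsub>aut_group X\<^esub> = (\<lambda>x\<in>X. x)"
  by (simp add: aut_group_def BijGroup_def)

lemma aut_group_apply_closed: "f \<in> carrier (aut_group X) \<Longrightarrow> x \<in> X \<Longrightarrow> f x \<in> X"
  by (auto simp: mem_aut_group_iff affine_morphism_def)

lemma aut_group_eqI: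
  assumes "f \<in> carrier (aut_group X)" "g \<in> carrier (aut_group X)" "\<And>x. x \<in> X \<Longrightarrow> f x = g x"
  shows "f = g"
  using assms by (auto simp: mem_aut_group_iff Bij_def intro: extensionalityI)

lemma aut_group_inv_apply:
  assumes "f \<in> carrier (aut_group X)" "x \<in> X"
  shows "(inv\<^bsub>aut_group X\<^esub> f) (f x) = x" "f ((inv\<^bsub>aut_group X\<^esub> f) x) = x"
proof -
  interpret group "aut_group X" by (rule group_aut_group)
  have "compose X (inv\<^bsub>aut_group X\<^esub> f) f = (\<lambda>x\<in>X. x)" "compose X f (inv\<^bsub>aut_group X\<^esub> f) = (\<lambda>x\<in>X. x)"
    using assms(1) by (simp_all flip: aut_group_mult add: aut_group_one)
  then show "(inv\<^bsub>aut_group X\<^esub> f) (f x) = x" "f ((inv\<^bsub>aut_group X\<^esub> f) x) = x"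
    using assms(2) by (metis compose_eq restrict_apply')+
qed

lemma aut_groupI:
  assumes "f \<in> extensional X" "affine_morphism X X f" "affine_morphism X X g"
    and "\<And>x. x \<in> X \<Longrightarrow> g (f x) = x" "\<And>x. x \<in> X \<Longrightarrow> f (g x) = x"
  shows "f \<in> carrier (aut_group X)"
proof -
  have bij: "bij_betw f X X"
    using assms by (intro bij_betw_byWitness[of _ g]) (auto simp: affine_morphism_def)
  then have "inv_into X f x = g x" if "x \<in> X" for x
    using assms that by (metis affine_morphism_def bij_betw_imp_inj_on funcset_mem inv_into_f_eq)
  then have "affine_morphism X X (inv_into X f)"
    using assms(3) affine_morphism_cong by blast
  then show ?thesis
    using assms bij by (simp add: aut_group_def Bij_def)
qed

lemma aut_group_regular_compose:
  assumes "g \<in> carrier (aut_group X)" "f \<in> regular_functions X"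
  shows "restrict0 X (\<lambda>x. f (g x)) \<in> regular_functions X"
proof -
  obtain F where F: "\<And>i. polynomial_map (F i)" "\<And>x i. x \<in> X \<Longrightarrow> g x $ i = F i (($) x)"
    using assms(1) by (auto simp: mem_aut_group_iff affine_morphism_iff)
  obtain G where G: "polynomial_map G" "\<And>x. x \<in> X \<Longrightarrow> f x = G (($) x)"
    using regular_functionsE[OF assms(2)] by metis
  have "($) (g x) = (\<lambda>j. F j (($) x))" if "x \<in> X" for x
    using F(2) that by auto
  then have "restrict0 X (\<lambda>x. f (g x)) = restrict0 X (\<lambda>x. G (\<lambda>j. F j (($) x)))"
    using G(2) aut_group_apply_closed[OF assms(1)] by (auto simp: restrict0_def)
  then show ?thesis
    using regular_functionsI[OF polynomial_map_compose[OF G(1) F(1)]] by simp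
qed

section \<open>Actions of the multiplicative group as gradings\<close>

lemma group_Gm: "group (Gm :: 'a::field monoid)"
proof (rule groupI)
  fix x :: 'a assume "x \<in> carrier Gm"
  then show "\<exists>y\<in>carrier Gm. y \<otimes>\<^bsub>Gm\<^esub> x = \<one>\<^bsub>Gm\<^esub>"
    by (intro bexI[of _ "inverse x"]) (auto simp: Gm_def)
qed (auto simp: Gm_def mult.assoc)

lemma sum_fun_apply: "(\<Sum>i\<in>I. F i) x = (\<Sum>i\<in>I. F i x)"
  by (induction I rule: infinite_finite_induct) (auto simp: pointwise)

definition laurent_expansion ::
    "('a::field_char_0 ^ 'n) set \<Rightarrow> ('a \<Rightarrow> 'a ^ 'n \<Rightarrow> 'a) \<Rightarrow> (int \<Rightarrow> 'a ^ 'n \<Rightarrow> 'a) \<Rightarrow> bool"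
  where "laurent_expansion X h g \<longleftrightarrow>
    (\<forall>w. g w \<in> regular_functions X) \<and> finite {w. g w \<noteq> 0} \<and>
    (\<forall>t x. t \<noteq> 0 \<longrightarrow> x \<in> X \<longrightarrow> h t x = (\<Sum>w | g w \<noteq> 0. t powi w * g w x))"

lemma laurent_expansion_superset:
  assumes "laurent_expansion X h g" "finite S" "{w. g w \<noteq> 0} \<subseteq> S" "t \<noteq> 0" "x \<in> X"
  shows "h t x = (\<Sum>w\<in>S. t powi w * g w x)"
proof -
  have "(\<Sum>w | g w \<noteq> 0. t powi w * g w x) = (\<Sum>w\<in>S. t powi w * g w x)"
    using assms(2,3) by (intro sum.mono_neutral_left) (auto simp: zero_fun_apply)
  then show ?thesis
    using assms by (simp add: laurent_expansion_def)
qed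

lemma laurent_expansionI:
  assumes "\<And>w. g w \<in> regular_functions X" "finite S" "\<And>w. w \<notin> S \<Longrightarrow> g w = 0"
    and "\<And>t x. t \<noteq> 0 \<Longrightarrow> x \<in> X \<Longrightarrow> h t x = (\<Sum>w\<in>S. t powi w * g w x)"
  shows "laurent_expansion X h g"
proof -
  have sub: "{w. g w \<noteq> 0} \<subseteq> S"
    using assms(3) by auto
  then have "(\<Sum>w | g w \<noteq> 0. t powi w * g w x) = (\<Sum>w\<in>S. t powi w * g w x)" for t x
    using assms(2) by (intro sum.mono_neutral_left) (auto simp: zero_fun_apply)
  then show ?thesis
    using assms sub finite_subset by (auto simp: laurent_expansion_def)
qed

text \<open>After multiplication by a power of \<open>t\<close> the difference is a polynomial that vanishes at all
  nonzero elements of an infinite field.\<close>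

lemma laurent_coefficients_unique:
  fixes a b :: "int \<Rightarrow> 'a::field_char_0"
  assumes "finite S" "\<And>t. t \<noteq> 0 \<Longrightarrow> (\<Sum>w\<in>S. t powi w * a w) = (\<Sum>w\<in>S. t powi w * b w)" "w \<in> S"
  shows "a w = b w"
proof -
  obtain N where N: "\<And>w. w \<in> S \<Longrightarrow> w \<ge> N"
    using assms(1) by (meson finite_has_minimal2 bdd_below_finite bdd_below_def)
  define p where "p = (\<Sum>w\<in>S. monom (a w - b w) (nat (w - N)))"
  have "poly p t = 0" if "t \<noteq> 0" for t
  proof -
    have "poly p t = (\<Sum>w\<in>S. t powi (- N) * (t powi w * a w - t powi w * b w))"
      unfolding p_def poly_sum
    proof (rule sum.cong)
      fix w assume "w \<in> S"
      then have "t ^ nat (w - N) = t powi (w - N)"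
        using N by (simp add: power_int_def)
      also have "\<dots> = t powi (- N) * t powi w"
        using that by (simp flip: power_int_add)
      finally show "poly (monom (a w - b w) (nat (w - N))) t =
          t powi (- N) * (t powi w * a w - t powi w * b w)"
        by (simp add: poly_monom algebra_simps)
    qed simp
    also have "\<dots> = 0"
      using assms(2)[OF that] by (simp flip: sum_distrib_left add: sum_subtractf)
    finally show ?thesis .
  qed
  then have "UNIV - {0} \<subseteq> {t. poly p t = 0}" by auto
  moreover have "infinite (UNIV - {0 :: 'a})"
    by (simp add: infinite_UNIV_char_0)
  ultimately have "p = 0"
    using finite_subset poly_roots_finite by blast
  then have "0 = (\<Sum>v\<in>S. coeff (monom (a v - b v) (nat (v - N))) (nat (w - N)))"
    using p_def by (metis coeff_0 coeff_sum)
  also have "\<dots> = (\<Sum>v\<in>S. if v = w then a w - b w else 0)"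
    using N assms(3) by (intro sum.cong) (auto simp: eq_nat_nat_iff)
  also have "\<dots> = a w - b w"
    using assms(1,3) by simp
  finally show ?thesis by simp
qed

lemma laurent_expansion_unique:
  assumes "laurent_expansion X h g" "laurent_expansion X h g'"
  shows "g = g'"
proof
  fix w
  show "g w = g' w"
  proof (rule regular_functions_eqI[of _ X])
    fix x assume x: "x \<in> X"
    let ?S = "insert w ({w. g w \<noteq> 0} \<union> {w. g' w \<noteq> 0})"
    have S: "finite ?S"
      using assms by (simp add: laurent_expansion_def)
    have "(\<Sum>w\<in>?S. t powi w * g w x) = (\<Sum>w\<in>?S. t powi w * g' w x)" if "t \<noteq> 0" for t
    proof -
      have "h t x = (\<Sum>w\<in>?S. t powi w * g w x)"
        by (rule laurent_expansion_superset[OF assms(1) S _ that x]) auto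
      moreover have "h t x = (\<Sum>w\<in>?S. t powi w * g' w x)"
        by (rule laurent_expansion_superset[OF assms(2) S _ that x]) auto
      ultimately show ?thesis by simp
    qed
    then show "g w x = g' w x"
      using laurent_coefficients_unique[OF S, of "\<lambda>w. g w x" "\<lambda>w. g' w x" w] by simp
  qed (use assms in \<open>auto simp: laurent_expansion_def\<close>)
qed

lemma laurent_expansion_monomial:
  assumes "g \<in> regular_functions X" "\<And>t x. t \<noteq> 0 \<Longrightarrow> x \<in> X \<Longrightarrow> h t x = t powi w * g x"
  shows "laurent_expansion X h (\<lambda>v. if v = w then g else 0)"
proof -
  interpret function_algebra "regular_functions X" by (rule function_algebra_regular_functions)
  show ?thesis
    using assms by (intro laurent_expansionI[of _ _ "{w}"]) auto
qed

lemma laurent_expansion_add: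
  assumes "laurent_expansion X h g" "laurent_expansion X h' g'"
  shows "laurent_expansion X (\<lambda>t x. h t x + h' t x) (\<lambda>w. g w + g' w)"
proof -
  interpret function_algebra "regular_functions X" by (rule function_algebra_regular_functions)
  let ?S = "{w. g w \<noteq> 0} \<union> {w. g' w \<noteq> 0}"
  have S: "finite ?S"
    using assms by (simp add: laurent_expansion_def)
  show ?thesis
  proof (rule laurent_expansionI[OF _ S])
    show "g w + g' w \<in> regular_functions X" for w
      using assms by (simp add: laurent_expansion_def)
    fix t :: 'a and x assume "t \<noteq> 0" "x \<in> X"
    then show "h t x + h' t x = (\<Sum>w\<in>?S. t powi w * (g w + g' w) x)"
      using laurent_expansion_superset[OF assms(1) S] laurent_expansion_superset[OF assms(2) S]
      by (simp add: pointwise distrib_left sum.distrib)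
  qed auto
qed

definition laurent :: "('a::field_char_0 ^ 'n) set \<Rightarrow> ('a \<Rightarrow> 'a ^ 'n \<Rightarrow> 'a) \<Rightarrow> bool"
  where "laurent X h \<longleftrightarrow> (\<exists>g. laurent_expansion X h g)"

lemma laurent_monomial:
  assumes "g \<in> regular_functions X" "\<And>t x. t \<noteq> 0 \<Longrightarrow> x \<in> X \<Longrightarrow> h t x = t powi w * g x"
  shows "laurent X h"
  unfolding laurent_def using laurent_expansion_monomial[OF assms] by blast

lemma laurent_add: "laurent X h \<Longrightarrow> laurent X h' \<Longrightarrow> laurent X (\<lambda>t x. h t x + h' t x)"
  unfolding laurent_def using laurent_expansion_add by blast

lemma laurent_const: "laurent X (\<lambda>_ _. c)"
  by (rule laurent_monomial[OF const_regular[of X c], where w = 0]) (simp add: restrict0_def)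

lemma laurent_sum: "(\<And>i. i \<in> I \<Longrightarrow> laurent X (h i)) \<Longrightarrow> laurent X (\<lambda>t x. \<Sum>i\<in>I. h i t x)"
  by (induction I rule: infinite_finite_induct) (auto intro: laurent_const laurent_add)

lemma laurent_cong:
  "laurent X h \<Longrightarrow> (\<And>t x. t \<noteq> 0 \<Longrightarrow> x \<in> X \<Longrightarrow> h t x = h' t x) \<Longrightarrow> laurent X h'"
  unfolding laurent_def laurent_expansion_def by (elim exE, intro exI) auto

lemma laurent_mult:
  assumes "laurent X h" "laurent X h'"
  shows "laurent X (\<lambda>t x. h t x * h' t x)"
proof -
  interpret function_algebra "regular_functions X" by (rule function_algebra_regular_functions)
  obtain g g' where g: "laurent_expansion X h g" "laurent_expansion X h' g'"
    using assms by (auto simp: laurent_def)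
  have "laurent X (\<lambda>t x. \<Sum>u | g u \<noteq> 0. \<Sum>v | g' v \<noteq> 0. (t powi u * g u x) * (t powi v * g' v x))"
  proof (intro laurent_sum)
    fix u v
    show "laurent X (\<lambda>t x. (t powi u * g u x) * (t powi v * g' v x))"
      using g by (intro laurent_monomial[of "g u * g' v" _ _ "u + v"])
        (auto simp: laurent_expansion_def pointwise power_int_add)
  qed
  then show ?thesis
  proof (rule laurent_cong)
    fix t :: 'a and x assume "t \<noteq> 0" "x \<in> X"
    then show "(\<Sum>u | g u \<noteq> 0. \<Sum>v | g' v \<noteq> 0. (t powi u * g u x) * (t powi v * g' v x)) = h t x * h' t x"
      using g by (simp add: laurent_expansion_def sum_product)
  qed
qed

lemma laurent_polynomial_map:
  assumes "polynomial_map F" "\<And>i. laurent X (\<lambda>t x. h i t x)"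
  shows "laurent X (\<lambda>t x. F (\<lambda>i. h i t x))"
  using assms(1)
  by (induction F rule: polynomial_map_induct) (auto intro: assms(2) laurent_const laurent_add laurent_mult)

text \<open>A regular action of the multiplicative group, with regularity expressed by Laurent expansions of the
  coordinates. The functions \<open>f\<close> with \<open>f (\<beta> t x) = t powi w * f x\<close> are the homogeneous elements of a
  grading.\<close>

locale Gm_action =
  fixes X :: "('a::field_char_0 ^ 'n) set" and \<beta> :: "'a \<Rightarrow> 'a ^ 'n \<Rightarrow> 'a ^ 'n"
  assumes hom: "\<beta> \<in> hom Gm (aut_group X)"
    and laurent: "laurent X (\<lambda>t x. \<beta> t x $ i)"
begin

lemma aut: "t \<noteq> 0 \<Longrightarrow> \<beta> t \<in> carrier (aut_group X)"
  using hom by (auto simp: hom_def Gm_def)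

lemma apply_closed: "t \<noteq> 0 \<Longrightarrow> x \<in> X \<Longrightarrow> \<beta> t x \<in> X"
  using aut aut_group_apply_closed by blast

lemma mult_apply:
  assumes "s \<noteq> 0" "t \<noteq> 0" "x \<in> X"
  shows "\<beta> (s * t) x = \<beta> s (\<beta> t x)"
proof -
  have "\<beta> (s * t) = \<beta> s \<otimes>\<^bsub>aut_group X\<^esub> \<beta> t"
    using hom assms by (auto simp: hom_def Gm_def)
  then show ?thesis
    using assms by (simp add: aut_group_mult aut compose_eq)
qed

lemma one_apply: "x \<in> X \<Longrightarrow> \<beta> 1 x = x"
  using hom_one[OF hom group_Gm group_aut_group] by (simp add: Gm_def aut_group_one)

sublocale function_algebra "regular_functions X"
  by (rule function_algebra_regular_functions)

lemma laurent_regular: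
  assumes "f \<in> regular_functions X"
  shows "laurent X (\<lambda>t x. f (\<beta> t x))"
proof -
  obtain F where F: "polynomial_map F" "\<And>x. x \<in> X \<Longrightarrow> f x = F (($) x)"
    using regular_functionsE[OF assms] by metis
  have "laurent X (\<lambda>t x. F (\<lambda>i. \<beta> t x $ i))"
    by (rule laurent_polynomial_map[OF F(1) laurent])
  then show ?thesis
    by (rule laurent_cong) (simp add: F(2) apply_closed)
qed

definition weight_component :: "int \<Rightarrow> ('a ^ 'n \<Rightarrow> 'a) \<Rightarrow> 'a ^ 'n \<Rightarrow> 'a"
  where "weight_component w f = (SOME g. laurent_expansion X (\<lambda>t x. f (\<beta> t x)) g) w"

lemma laurent_expansion_weight_component:
  assumes "f \<in> regular_functions X"
  shows "laurent_expansion X (\<lambda>t x. f (\<beta> t x)) (\<lambda>w. weight_component w f)"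
  using laurent_regular[OF assms] unfolding weight_component_def laurent_def by (rule someI_ex)

lemma weight_component_eqI:
  assumes "laurent_expansion X (\<lambda>t x. f (\<beta> t x)) g"
  shows "weight_component w f = g w"
proof -
  have "laurent_expansion X (\<lambda>t x. f (\<beta> t x)) (\<lambda>w. weight_component w f)"
    unfolding weight_component_def by (rule someI[of _ g]) (rule assms)
  then have "(\<lambda>w. weight_component w f) = g"
    using assms by (rule laurent_expansion_unique)
  then show ?thesis by (rule fun_cong)
qed

text \<open>Compare the coefficients in \<open>t\<close> of the two expansions of \<open>f\<close> at the point \<open>\<beta> (t * s) x\<close>.\<close>

lemma weight_component_homogeneous:
  assumes "f \<in> regular_functions X" "s \<noteq> 0" "x \<in> X"
  shows "weight_component w f (\<beta> s x) = s powi w * weight_component w f x"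
proof -
  let ?S = "insert w {w. weight_component w f \<noteq> 0}"
  note expansion = laurent_expansion_weight_component[OF assms(1)]
  have S: "finite ?S"
    using expansion by (simp add: laurent_expansion_def)
  have "(\<Sum>w\<in>?S. t powi w * weight_component w f (\<beta> s x)) =
      (\<Sum>w\<in>?S. t powi w * (s powi w * weight_component w f x))" if "t \<noteq> 0" for t
  proof -
    have "(\<Sum>w\<in>?S. t powi w * weight_component w f (\<beta> s x)) = f (\<beta> t (\<beta> s x))"
      using that assms apply_closed
      by (intro laurent_expansion_superset[OF expansion S, symmetric]) auto
    also have "\<dots> = f (\<beta> (t * s) x)"
      using that assms by (simp add: mult_apply)
    also have "\<dots> = (\<Sum>w\<in>?S. (t * s) powi w * weight_component w f x)"
      using that assms by (intro laurent_expansion_superset[OF expansion S]) auto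
    finally show ?thesis
      by (simp add: power_int_mult_distrib mult.assoc)
  qed
  then show ?thesis
    using laurent_coefficients_unique[OF S, of "\<lambda>w. weight_component w f (\<beta> s x)"
        "\<lambda>w. s powi w * weight_component w f x" w] by simp
qed

lemma homogeneous_apply:
  assumes "f \<in> regular_functions X" "weight_component w f = f" "t \<noteq> 0" "x \<in> X"
  shows "f (\<beta> t x) = t powi w * f x"
  using weight_component_homogeneous[OF assms(1,3,4), of w] assms(2) by simp

lemma grading: "grading (regular_functions X) weight_component"
proof
  fix f w assume f: "f \<in> regular_functions X"
  note expansion = laurent_expansion_weight_component[OF f]
  show closed: "weight_component w f \<in> regular_functions X"
    using expansion by (simp add: laurent_expansion_def)
  show "finite {w. weight_component w f \<noteq> 0}"
    using expansion by (simp add: laurent_expansion_def)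
  show "(\<Sum>w | weight_component w f \<noteq> 0. weight_component w f) = f"
  proof (rule regular_functions_eqI)
    fix x assume x: "x \<in> X"
    have "f (\<beta> 1 x) = (\<Sum>w | weight_component w f \<noteq> 0. 1 powi w * weight_component w f x)"
      using expansion x by (intro laurent_expansion_superset) (auto simp: laurent_expansion_def)
    then show "(\<Sum>w | weight_component w f \<noteq> 0. weight_component w f) x = f x"
      using x by (simp add: sum_fun_apply one_apply)
  qed (use expansion f in \<open>auto simp: laurent_expansion_def intro!: sum_closed\<close>)
  show "weight_component v (weight_component w f) = (if v = w then weight_component w f else 0)" for v
    using weight_component_homogeneous[OF f] closed
    by (intro weight_component_eqI laurent_expansion_monomial) auto
  show "weight_component w ((\<lambda>_. c) * f) = (\<lambda>_. c) * weight_component w f" for c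
  proof (rule weight_component_eqI, rule laurent_expansionI)
    show "finite {w. weight_component w f \<noteq> 0}"
      using expansion by (simp add: laurent_expansion_def)
    show "(\<lambda>_. c) * weight_component w f \<in> regular_functions X" for w
      using expansion by (simp add: laurent_expansion_def)
    fix t :: 'a and x assume "t \<noteq> 0" "x \<in> X"
    then have "f (\<beta> t x) = (\<Sum>w | weight_component w f \<noteq> 0. t powi w * weight_component w f x)"
      using expansion by (simp add: laurent_expansion_def)
    then show "((\<lambda>_. c) * f) (\<beta> t x) =
        (\<Sum>w | weight_component w f \<noteq> 0. t powi w * ((\<lambda>_. c) * weight_component w f) x)"
      by (simp add: pointwise sum_distrib_left algebra_simps)
  qed auto
  fix g assume g: "g \<in> regular_functions X"
  show "weight_component w (f + g) = weight_component w f + weight_component w g"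
  proof (rule weight_component_eqI)
    show "laurent_expansion X (\<lambda>t x. (f + g) (\<beta> t x)) (\<lambda>w. weight_component w f + weight_component w g)"
      using laurent_expansion_add[OF expansion laurent_expansion_weight_component[OF g]]
      by (simp add: plus_fun_apply[abs_def])
  qed
next
  fix f g u v
  assume fg: "f \<in> regular_functions X" "g \<in> regular_functions X"
    "weight_component u f = f" "weight_component v g = g"
  have "laurent_expansion X (\<lambda>t x. (f * g) (\<beta> t x)) (\<lambda>w. if w = u + v then f * g else 0)"
  proof (rule laurent_expansion_monomial)
    show "f * g \<in> regular_functions X" using fg by simp
    fix t :: 'a and x assume "t \<noteq> 0" "x \<in> X"
    then show "(f * g) (\<beta> t x) = t powi (u + v) * (f * g) x"
      using homogeneous_apply[OF fg(1,3)] homogeneous_apply[OF fg(2,4)]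
      by (simp add: pointwise power_int_add)
  qed
  from weight_component_eqI[OF this, of "u + v"]
  show "weight_component (u + v) (f * g) = f * g" by simp
qed

lemma weight_expansion:
  assumes "f \<in> regular_functions X" "finite S" "{w. weight_component w f \<noteq> 0} \<subseteq> S" "t \<noteq> 0" "x \<in> X"
  shows "f (\<beta> t x) = (\<Sum>w\<in>S. t powi w * weight_component w f x)"
  using laurent_expansion_superset[OF laurent_expansion_weight_component[OF assms(1)] assms(2-5)] .

end

text \<open>On a rigid variety the gradings of the two actions commute. Expanding a coordinate at
  \<open>\<beta> s (\<gamma> t x)\<close> and at \<open>\<gamma> t (\<beta> s x)\<close> gives double sums whose terms are exchanged by this.\<close>

theorem Gm_actions_commute:
  fixes X :: "('a::field_char_0 ^ 'n) set"
  assumes "rigid X" "Gm_action X \<beta>" "Gm_action X \<gamma>" "s \<noteq> 0" "t \<noteq> 0" "x \<in> X"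
  shows "\<beta> s (\<gamma> t x) = \<gamma> t (\<beta> s x)"
proof -
  interpret \<beta>: Gm_action X \<beta> by fact
  interpret \<gamma>: Gm_action X \<gamma> by fact
  interpret B: grading "regular_functions X" \<beta>.weight_component by (rule \<beta>.grading)
  interpret C: grading "regular_functions X" \<gamma>.weight_component by (rule \<gamma>.grading)
  let ?B = \<beta>.weight_component and ?C = \<gamma>.weight_component
  have no_lnd: "D f = 0"
    if "\<beta>.derivation D" "\<beta>.locally_nilpotent D" "f \<in> regular_functions X" for D f
  proof -
    interpret locally_nilpotent_derivation X D
      using that \<open>rigid X\<close> by unfold_locales (auto simp: rigid_def affine_variety_def)
    show ?thesis by (rule eq_zero_if_rigid[OF \<open>rigid X\<close> that(3)])
  qed
  have commute: "?B e (?C w f) = ?C w (?B e f)" if "f \<in> regular_functions X" for e w f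
  proof (rule \<beta>.gradings_commute[OF \<beta>.grading \<gamma>.grading, of "range (coordinate X)"])
    show "\<forall>f\<in>regular_functions X. D f = 0"
      if "\<beta>.derivation D" "\<forall>g\<in>range (coordinate X). D g = 0" for D
      using derivation_regular_eq_zero[OF that(1)] that(2) by auto
  qed (use that no_lnd in auto)
  have "coordinate X i (\<beta> s (\<gamma> t x)) = coordinate X i (\<gamma> t (\<beta> s x))" for i
  proof -
    let ?f = "coordinate X i"
    let ?E = "{e. ?B e ?f \<noteq> 0}" and ?W = "{w. ?C w ?f \<noteq> 0}"
    have fin: "finite ?E" "finite ?W"
      by (auto intro: B.finite_support C.finite_support)
    have "?f (\<beta> s (\<gamma> t x)) = (\<Sum>e\<in>?E. s powi e * ?B e ?f (\<gamma> t x))"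
      using assms fin \<gamma>.apply_closed by (intro \<beta>.weight_expansion) auto
    also have "\<dots> = (\<Sum>e\<in>?E. s powi e * (\<Sum>w\<in>?W. t powi w * ?C w (?B e ?f) x))"
    proof (intro sum.cong refl arg_cong2[where f = "(*)"] \<gamma>.weight_expansion)
      show "{w. ?C w (?B e ?f) \<noteq> 0} \<subseteq> ?W" for e
        using commute[OF coordinate_regular, symmetric] by (auto simp: B.comp_zero)
    qed (use assms fin in auto)
    also have "\<dots> = (\<Sum>w\<in>?W. t powi w * (\<Sum>e\<in>?E. s powi e * ?B e (?C w ?f) x))"
      by (simp add: sum_distrib_left commute sum.swap[of _ ?W] mult.left_commute)
    also have "\<dots> = (\<Sum>w\<in>?W. t powi w * ?C w ?f (\<beta> s x))"
    proof (intro sum.cong refl arg_cong2[where f = "(*)"] \<beta>.weight_expansion[symmetric])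
      show "{e. ?B e (?C w ?f) \<noteq> 0} \<subseteq> ?E" for w
        using commute[OF coordinate_regular] by (auto simp: C.comp_zero)
    qed (use assms fin in auto)
    also have "\<dots> = ?f (\<gamma> t (\<beta> s x))"
      using assms fin \<beta>.apply_closed by (intro \<gamma>.weight_expansion[symmetric]) auto
    finally show ?thesis .
  qed
  then show ?thesis
    using assms \<beta>.apply_closed \<gamma>.apply_closed by (simp add: vec_eq_iff coordinate_apply)
qed

section \<open>Linear maps on irreducible cones\<close>

lemma poly_eq_if_eq_nonzero:
  fixes p q :: "'a::field_char_0 poly"
  assumes "\<And>c. c \<noteq> 0 \<Longrightarrow> poly p c = poly q c"
  shows "p = q"
proof -
  have "UNIV - {0} \<subseteq> {c. poly (p - q) c = 0}"
    using assms by auto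
  moreover have "infinite (UNIV - {0 :: 'a})"
    by (simp add: infinite_UNIV_char_0)
  ultimately have "p - q = 0"
    using finite_subset poly_roots_finite by blast
  then show ?thesis by simp
qed

text \<open>On the lines through the origin a polynomial map is a polynomial in the parameter whose linear
  coefficient is a linear form in the direction. Here \<open>a\<close> and \<open>b\<close> do not depend on the direction.\<close>

lemma polynomial_map_on_line:
  fixes F :: "('i::finite \<Rightarrow> 'a::comm_ring_1) \<Rightarrow> 'a"
  assumes "polynomial_map F"
  shows "\<exists>b a. \<forall>v. \<exists>r. \<forall>c. F (\<lambda>i. c * v i) = poly (pCons b (pCons (\<Sum>i\<in>UNIV. a i * v i) r)) c"
  using assms
proof (induction F rule: polynomial_map_induct)
  case (const c)
  then show ?case
    by (intro exI[of _ c] exI[of _ "\<lambda>_. 0"] allI exI[of _ 0]) simp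
next
  case (var i)
  then show ?case
    by (intro exI[of _ 0] exI[of _ "\<lambda>j. if j = i then 1 else 0"] allI exI[of _ 0])
       (simp add: if_distrib[of "\<lambda>x. x * _"] cong: if_cong)
next
  case (add F G)
  then obtain b a b' a' where
    *: "\<forall>v. \<exists>r. \<forall>c. F (\<lambda>i. c * v i) = poly (pCons b (pCons (\<Sum>i\<in>UNIV. a i * v i) r)) c"
       "\<forall>v. \<exists>r. \<forall>c. G (\<lambda>i. c * v i) = poly (pCons b' (pCons (\<Sum>i\<in>UNIV. a' i * v i) r)) c"
    by blast
  show ?case
  proof (intro exI[of _ "b + b'"] exI[of _ "\<lambda>i. a i + a' i"] allI)
    fix v
    obtain r r' where r: "\<forall>c. F (\<lambda>i. c * v i) = poly (pCons b (pCons (\<Sum>i\<in>UNIV. a i * v i) r)) c"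
       "\<forall>c. G (\<lambda>i. c * v i) = poly (pCons b' (pCons (\<Sum>i\<in>UNIV. a' i * v i) r')) c"
      using * by meson
    show "\<exists>r. \<forall>c. F (\<lambda>i. c * v i) + G (\<lambda>i. c * v i) =
        poly (pCons (b + b') (pCons (\<Sum>i\<in>UNIV. (a i + a' i) * v i) r)) c"
      by (intro exI[of _ "r + r'"]) (simp add: r sum.distrib algebra_simps)
  qed
next
  case (mult F G)
  then obtain b a b' a' where
    *: "\<forall>v. \<exists>r. \<forall>c. F (\<lambda>i. c * v i) = poly (pCons b (pCons (\<Sum>i\<in>UNIV. a i * v i) r)) c"
       "\<forall>v. \<exists>r. \<forall>c. G (\<lambda>i. c * v i) = poly (pCons b' (pCons (\<Sum>i\<in>UNIV. a' i * v i) r)) c"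
    by blast
  show ?case
  proof (intro exI[of _ "b * b'"] exI[of _ "\<lambda>i. b * a' i + b' * a i"] allI)
    fix v
    define l l' where "l = (\<Sum>i\<in>UNIV. a i * v i)" and "l' = (\<Sum>i\<in>UNIV. a' i * v i)"
    obtain r r' where r: "\<forall>c. F (\<lambda>i. c * v i) = poly (pCons b (pCons l r)) c"
       "\<forall>c. G (\<lambda>i. c * v i) = poly (pCons b' (pCons l' r')) c"
      using * unfolding l_def l'_def by meson
    have l: "(\<Sum>i\<in>UNIV. (b * a' i + b' * a i) * v i) = b * l' + b' * l"
      unfolding l_def l'_def by (simp add: sum.distrib sum_distrib_left algebra_simps)
    \<comment> \<open>the terms of order at least two in the product, divided by the square of the parameter\<close>
    define q where "q = smult b r' + smult b' r + [:l * l':] + pCons 0 (smult l r' + smult l' r)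
      + pCons 0 (pCons 0 (r * r'))"
    show "\<exists>r. \<forall>c. F (\<lambda>i. c * v i) * G (\<lambda>i. c * v i) =
        poly (pCons (b * b') (pCons (\<Sum>i\<in>UNIV. (b * a' i + b' * a i) * v i) r)) c"
      unfolding l by (intro exI[of _ q]) (simp add: r q_def algebra_simps)
  qed
qed

lemma homogeneous_linear_form:
  fixes a :: "'n::finite \<Rightarrow> 'a::field"
  obtains p where "homogeneous_mpoly 1 p" "\<And>v. mpoly_eval v p = (\<Sum>i\<in>UNIV. a i * v i)"
proof -
  define p where "p = (\<Sum>i\<in>UNIV. Poly_Mapping.single (Poly_Mapping.single i (1::nat)) (a i))"
  have "Poly_Mapping.keys p \<subseteq> range (\<lambda>i. Poly_Mapping.single i 1)"
    unfolding p_def using keys_sum by (fastforce split: if_splits)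
  then have "homogeneous_mpoly 1 p"
    by (auto simp: homogeneous_mpoly_def)
  moreover have "mpoly_eval v p = (\<Sum>i\<in>UNIV. a i * v i)" for v
    by (simp add: p_def mpoly_eval_sum mpoly_eval_single monomial_value_def)
  ultimately show ?thesis using that by blast
qed

lemma eigenvectors_independent:
  fixes A :: "'a::field ^ 'n ^ 'n"
  assumes "finite S" "\<And>l. l \<in> S \<Longrightarrow> e l \<noteq> 0 \<and> A *v e l = l *s e l"
    and "(\<Sum>l\<in>S. c l *s e l) = 0" "l \<in> S"
  shows "c l = 0"
  using assms
proof (induction S arbitrary: c l rule: finite_induct)
  case (insert m S)
  have sum: "c m *s e m + (\<Sum>l\<in>S. c l *s e l) = 0"
    using insert by simp
  then have "A *v (c m *s e m + (\<Sum>l\<in>S. c l *s e l)) = 0"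
    by simp
  then have "c m *s (A *v e m) + (\<Sum>l\<in>S. c l *s (A *v e l)) = 0"
    by (simp add: matrix_vector_right_distrib vector_scalar_commute vec.linear_sum matrix_vector_mul_linear_gen
        linear_sum)
  then have "(m * c m) *s e m + (\<Sum>l\<in>S. (l * c l) *s e l) = 0"
    using insert.prems(1) by (simp add: vector_smult_assoc mult.commute)
  moreover have "(m * c m) *s e m + (\<Sum>l\<in>S. (m * c l) *s e l) = 0"
    using arg_cong[OF sum, of "\<lambda>v. m *s v"] 
    by (simp add: vector_add_ldistrib vector_smult_assoc vec.scale_sum_right)
  ultimately have "(m * c m) *s e m + (\<Sum>l\<in>S. (l * c l) *s e l) =
      (m * c m) *s e m + (\<Sum>l\<in>S. (m * c l) *s e l)"
    by (simp only:)
  then have "(\<Sum>l\<in>S. (l * c l) *s e l) - (\<Sum>l\<in>S. (m * c l) *s e l) = 0"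
    by simp
  then have "(\<Sum>l\<in>S. ((l - m) * c l) *s e l) = 0"
    by (simp add: sum_subtractf[symmetric] vec.scale_left_diff_distrib left_diff_distrib)
  then have "(l - m) * c l = 0" if "l \<in> S" for l
    using insert.IH[of "\<lambda>l. (l - m) * c l"] insert.prems(1) that by blast
  then have S: "c l = 0" if "l \<in> S" for l
    using insert.hyps(2) that by auto
  then have "c m *s e m = 0"
    using sum by simp
  then have "c m = 0"
    using insert.prems(1)[of m] by (simp add: vector_mul_eq_0)
  then show ?case
    using S insert.prems(3) by blast
qed simp

lemma finite_eigenvalues:
  fixes A :: "'a::field ^ 'n ^ 'n"
  shows "finite {l. \<exists>x. x \<noteq> 0 \<and> A *v x = l *s x}"
proof (rule ccontr)
  assume inf: "infinite {l. \<exists>x. x \<noteq> 0 \<and> A *v x = l *s x}"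
  have "\<forall>l \<in> {l. \<exists>x. x \<noteq> 0 \<and> A *v x = l *s x}. \<exists>x. x \<noteq> 0 \<and> A *v x = l *s x"
    by blast
  from bchoice[OF this] obtain e where
    e: "\<And>l. l \<in> {l. \<exists>x. x \<noteq> 0 \<and> A *v x = l *s x} \<Longrightarrow> e l \<noteq> 0 \<and> A *v e l = l *s e l"
    by blast
  obtain S where S: "S \<subseteq> {l. \<exists>x. x \<noteq> 0 \<and> A *v x = l *s x}" "finite S" "card S = Suc CARD('n)"
    using infinite_arbitrarily_large[OF inf] by blast
  have eS: "e l \<noteq> 0 \<and> A *v e l = l *s e l" if "l \<in> S" for l
    using e S(1) that by blast
  have inj: "inj_on e S"
    using eS by (metis inj_onI vec.scale_right_imp_eq)
  have "vec.independent (e ` S)"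
  proof (rule vec.independent_if_scalars_zero)
    fix f x assume f: "(\<Sum>x\<in>e ` S. f x *s x) = 0" and "x \<in> e ` S"
    then obtain l where l: "l \<in> S" "x = e l" by blast
    have "(\<Sum>l\<in>S. f (e l) *s e l) = 0"
      using f inj by (simp add: sum.reindex)
    then have "f (e l) = 0"
      using eigenvectors_independent[OF S(2) eS, where c = "\<lambda>l. f (e l)" and l = l] l(1) by blast
    then show "f x = 0" using l by simp
  qed (use S in auto)
  then have "card (e ` S) \<le> CARD('n)"
    using vec.independent_card_le_dim[of "e ` S" UNIV] by (simp add: card_cart_basis)
  then show False
    using S inj by (simp add: card_image)
qed

lemma affine_closed_zero_set:
  assumes "polynomial_map F"
  shows "affine_closed {x. F (($) x) = 0}"
proof -
  obtain p where "\<And>v. F v = mpoly_eval v p"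
    using assms by (auto simp: polynomial_map_def)
  then show ?thesis
    unfolding affine_closed_def by (intro exI[of _ "{p}"]) simp
qed

lemma affine_closed_Inter:
  assumes "\<And>i. i \<in> I \<Longrightarrow> affine_closed (S i)"
  shows "affine_closed (\<Inter>i\<in>I. S i)"
proof -
  have "\<forall>i\<in>I. \<exists>P. S i = {x. \<forall>p\<in>P. mpoly_eval (($) x) p = 0}"
    using assms unfolding affine_closed_def by blast
  from bchoice[OF this] obtain P where
    "\<And>i. i \<in> I \<Longrightarrow> S i = {x. \<forall>p\<in>P i. mpoly_eval (($) x) p = 0}"
    by blast
  then show ?thesis
    unfolding affine_closed_def by (intro exI[of _ "\<Union>i\<in>I. P i"]) auto
qed

lemma affine_closed_empty: "affine_closed {}"
  using affine_closed_zero_set[OF polynomial_map_const[of 1]] by simp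

lemma affine_closed_Un:
  assumes "affine_closed S" "affine_closed T"
  shows "affine_closed (S \<union> T)"
proof -
  obtain P Q where "S = {x. \<forall>p\<in>P. mpoly_eval (($) x) p = 0}" "T = {x. \<forall>p\<in>Q. mpoly_eval (($) x) p = 0}"
    using assms by (auto simp: affine_closed_def)
  then have "S \<union> T = {x. \<forall>p \<in> (\<lambda>(p, q). p * q) ` (P \<times> Q). mpoly_eval (($) x) p = 0}"
    by (auto simp: mpoly_eval_mult)
  then show ?thesis
    unfolding affine_closed_def by blast
qed

lemma irreducible_subset_finite_Union:
  assumes "irreducible_wrt affine_closed X" "finite I"
    and "\<And>i. i \<in> I \<Longrightarrow> affine_closed (S i)" "X \<subseteq> (\<Union>i\<in>I. S i)"
  shows "\<exists>i\<in>I. X \<subseteq> S i"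
  using assms(2-4)
proof (induction I rule: finite_induct)
  case empty
  then show ?case
    using assms(1) unfolding irreducible_wrt_def by simp
next
  case (insert i I)
  have "affine_closed (\<Union>i\<in>I. S i)"
    using insert.hyps(1) insert.prems(1)
    by (induction I rule: finite_induct) (auto intro: affine_closed_empty affine_closed_Un)
  then have "X \<subseteq> S i \<or> X \<subseteq> (\<Union>i\<in>I. S i)"
    using assms(1) insert.prems unfolding irreducible_wrt_def by (metis UN_insert insertI1)
  then show ?case
    using insert by auto
qed

text \<open>The finitely many eigenspaces of \<open>A\<close> are closed and cover \<open>X\<close>, so one of them contains \<open>X\<close>.\<close>

lemma scalar_if_all_eigenvectors:
  fixes A :: "'a::field ^ 'n ^ 'n"
  assumes irr: "irreducible_wrt affine_closed X"
    and "x0 \<in> X" "x0 \<noteq> 0"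
    and eig: "\<And>x. x \<in> X \<Longrightarrow> \<exists>l. A *v x = l *s x"
  shows "\<exists>l. \<forall>x\<in>X. A *v x = l *s x"
proof -
  let ?I = "{l. \<exists>x. x \<noteq> 0 \<and> A *v x = l *s x}"
  define E where "E l = {x. A *v x = l *s x}" for l
  have closed: "affine_closed (E l)" for l
  proof -
    have "E l = (\<Inter>i\<in>UNIV. {x. (\<Sum>j\<in>UNIV. A $ i $ j * x $ j) + (- l) * x $ i = 0})"
      by (auto simp: E_def vec_eq_iff matrix_vector_mult_def)
    moreover have "affine_closed {x. (\<Sum>j\<in>UNIV. A $ i $ j * x $ j) + (- l) * x $ i = 0}" for i
    proof -
      have "polynomial_map (\<lambda>v. (\<Sum>j\<in>UNIV. A $ i $ j * v j) + (- l) * v i)"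
        by (intro polynomial_map_add polynomial_map_sum polynomial_map_mult polynomial_map_const
            polynomial_map_var)
      from affine_closed_zero_set[OF this] show ?thesis .
    qed
    ultimately show ?thesis
      by (simp add: affine_closed_Inter)
  qed
  have "X \<subseteq> (\<Union>l\<in>?I. E l)"
  proof
    fix x assume x: "x \<in> X"
    show "x \<in> (\<Union>l\<in>?I. E l)"
    proof (cases "x = 0")
      case True
      obtain l where "A *v x0 = l *s x0"
        using eig assms(2) by blast
      then show ?thesis
        using True assms(3) by (auto simp: E_def)
    next
      case False
      then show ?thesis
        using eig[OF x] by (auto simp: E_def)
    qed
  qed
  then have "\<exists>l\<in>?I. X \<subseteq> E l"
    by (rule irreducible_subset_finite_Union[OF irr finite_eigenvalues closed])
  then show ?thesis
    unfolding E_def by blast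
qed

definition scaling :: "('a::field ^ 'n) set \<Rightarrow> 'a \<Rightarrow> 'a ^ 'n \<Rightarrow> 'a ^ 'n"
  where "scaling X c = (\<lambda>x\<in>X. c *s x)"

lemma scaling_apply: "x \<in> X \<Longrightarrow> scaling X c x = c *s x"
  by (simp add: scaling_def)

lemma scalar_torus_eq: "scalar_torus X = scaling X ` (UNIV - {0})"
  by (auto simp: scalar_torus_def scaling_def)

locale irreducible_cone =
  fixes X :: "('a::field_char_0 ^ 'n) set"
  assumes irreducible: "irreducible_wrt affine_closed X"
    and cone: "x \<in> X \<Longrightarrow> c *s x \<in> X"
    and nonzero: "\<exists>x\<in>X. x \<noteq> 0"
begin

lemma zero_mem: "0 \<in> X"
  using nonzero cone[of _ 0] by auto

lemma scaling_aut:
  assumes "c \<noteq> 0"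
  shows "scaling X c \<in> carrier (aut_group X)"
proof (rule aut_groupI)
  have morphism: "affine_morphism X X (scaling X c)" for c
    unfolding affine_morphism_iff
    using polynomial_map_mult[OF polynomial_map_const polynomial_map_var]
    by (auto simp: scaling_apply cone intro!: exI[of _ "\<lambda>i v. c * v i"])
  show "affine_morphism X X (scaling X c)" "affine_morphism X X (scaling X (inverse c))"
    by (rule morphism)+
qed (use assms in \<open>auto simp: scaling_def cone vector_smult_assoc\<close>)

lemma scaling_mult:
  assumes "c \<noteq> 0" "d \<noteq> 0"
  shows "scaling X c \<otimes>\<^bsub>aut_group X\<^esub> scaling X d = scaling X (c * d)"
  unfolding aut_group_mult[OF scaling_aut[OF assms(1)] scaling_aut[OF assms(2)]]
  by (auto simp: compose_def scaling_def cone vector_smult_assoc)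

lemma scaling_one: "scaling X 1 = \<one>\<^bsub>aut_group X\<^esub>"
  by (auto simp: scaling_def aut_group_one)

lemma Gm_action_scaling: "Gm_action X (scaling X)"
proof
  show "scaling X \<in> hom Gm (aut_group X)"
    by (rule homI) (auto simp: Gm_def scaling_aut scaling_mult)
  show "laurent X (\<lambda>t x. scaling X t x $ i)" for i
    by (rule laurent_monomial[OF coordinate_regular, where w = 1])
       (simp add: scaling_apply coordinate_apply)
qed

definition centralizer :: "('a ^ 'n \<Rightarrow> 'a ^ 'n) set"
  where "centralizer = {f \<in> carrier (aut_group X). \<forall>c x. c \<noteq> 0 \<longrightarrow> x \<in> X \<longrightarrow> f (c *s x) = c *s f x}"

lemma centralizer_aut: "f \<in> centralizer \<Longrightarrow> f \<in> carrier (aut_group X)"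
  by (simp add: centralizer_def)

lemma subgroup_centralizer: "subgroup centralizer (aut_group X)"
proof -
  interpret group "aut_group X" by (rule group_aut_group)
  show ?thesis
  proof (rule subgroupI)
    show "centralizer \<subseteq> carrier (aut_group X)" by (auto simp: centralizer_def)
    show "centralizer \<noteq> {}"
      using one_closed cone by (auto simp: centralizer_def aut_group_one)
  next
    fix f assume f: "f \<in> centralizer"
    then have f': "f \<in> carrier (aut_group X)" by (rule centralizer_aut)
    show "inv\<^bsub>aut_group X\<^esub> f \<in> centralizer"
      unfolding centralizer_def
    proof (intro CollectI conjI allI impI)
      fix c y assume c: "c \<noteq> (0::'a)" and y: "y \<in> X"
      let ?x = "(inv\<^bsub>aut_group X\<^esub> f) y"
      have x: "?x \<in> X" using aut_group_apply_closed[OF inv_closed[OF f'] y] .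
      have "f (c *s ?x) = c *s y"
        using f c x aut_group_inv_apply(2)[OF f' y] by (simp add: centralizer_def)
      then show "(inv\<^bsub>aut_group X\<^esub> f) (c *s y) = c *s ?x"
        using aut_group_inv_apply(1)[OF f' cone[OF x, of c]] by simp
    qed (use f' in simp)
    fix g assume g: "g \<in> centralizer"
    then show "f \<otimes>\<^bsub>aut_group X\<^esub> g \<in> centralizer"
      using f' f m_closed[OF f' centralizer_aut[OF g]]
      by (auto simp: centralizer_def aut_group_mult compose_eq cone aut_group_apply_closed)
  qed
qed

text \<open>On the line through \<open>x\<close> a coordinate of \<open>f\<close> is both a polynomial in the parameter and a multiple of it,
  so only the linear coefficient survives.\<close>

lemma centralizer_linear:
  assumes "f \<in> centralizer"
  obtains A :: "'a ^ 'n ^ 'n" where "\<And>x. x \<in> X \<Longrightarrow> f x = A *v x"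
proof -
  obtain F where F: "\<And>i. polynomial_map (F i)" "\<And>x i. x \<in> X \<Longrightarrow> f x $ i = F i (($) x)"
    using centralizer_aut[OF assms] by (auto simp: mem_aut_group_iff affine_morphism_iff)
  have "\<exists>a. \<forall>x\<in>X. f x $ i = (\<Sum>j\<in>UNIV. a j * x $ j)" for i
  proof -
    obtain b a where a: "\<forall>v. \<exists>r. \<forall>c. F i (\<lambda>j. c * v j) = poly (pCons b (pCons (\<Sum>j\<in>UNIV. a j * v j) r)) c"
      using polynomial_map_on_line[OF F(1)] by blast
    have "f x $ i = (\<Sum>j\<in>UNIV. a j * x $ j)" if x: "x \<in> X" for x
    proof -
      obtain r where r: "\<And>c. F i (\<lambda>j. c * x $ j) = poly (pCons b (pCons (\<Sum>j\<in>UNIV. a j * x $ j) r)) c"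
        using a by blast
      have "pCons b (pCons (\<Sum>j\<in>UNIV. a j * x $ j) r) = [:0, f x $ i:]"
      proof (rule poly_eq_if_eq_nonzero)
        fix c :: 'a assume c: "c \<noteq> 0"
        have "poly (pCons b (pCons (\<Sum>j\<in>UNIV. a j * x $ j) r)) c = F i (($) (c *s x))"
          unfolding r[symmetric] by (rule arg_cong[of _ _ "F i"]) (simp add: fun_eq_iff)
        also have "\<dots> = f (c *s x) $ i"
          using F(2) cone[OF x] by simp
        also have "\<dots> = c * f x $ i"
          using assms c x by (simp add: centralizer_def)
        finally show "poly (pCons b (pCons (\<Sum>j\<in>UNIV. a j * x $ j) r)) c = poly [:0, f x $ i:] c"
          by simp
      qed
      then show ?thesis by simp
    qed
    then show ?thesis by blast
  qed
  then obtain a where a: "\<And>i x. x \<in> X \<Longrightarrow> f x $ i = (\<Sum>j\<in>UNIV. a i j * x $ j)"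
    by metis
  show ?thesis
  proof (rule that[of "\<chi> i j. a i j"])
    fix x assume "x \<in> X"
    then show "f x = (\<chi> i j. a i j) *v x"
      by (simp add: vec_eq_iff matrix_vector_mult_def a)
  qed
qed

lemma centralizer_zero: "f \<in> centralizer \<Longrightarrow> f 0 = 0"
  using centralizer_linear[of f] zero_mem by (metis matrix_vector_mult_0_right)

lemma centralizer_nonzero:
  assumes "f \<in> centralizer" "x \<in> X" "x \<noteq> 0"
  shows "f x \<noteq> 0"
  using assms aut_group_inv_apply(1)[OF centralizer_aut[OF assms(1)]] centralizer_zero[OF assms(1)] zero_mem
  by metis

lemma centralizer_scale:
  assumes "f \<in> centralizer" "x \<in> X"
  shows "f (c *s x) = c *s f x"
  using assms centralizer_zero[OF assms(1)] by (cases "c = 0") (auto simp: centralizer_def)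

lemma centralizer_image_span:
  assumes "f \<in> centralizer" "x \<in> X"
  shows "f ` vec.span {x} = vec.span {f x}"
  using assms by (auto simp: vec.span_singleton centralizer_scale image_image)

lemma mem_scalar_torus_if_preserves_lines:
  assumes f: "f \<in> centralizer" and lines: "\<And>x. x \<in> X \<Longrightarrow> x \<noteq> 0 \<Longrightarrow> f ` vec.span {x} = vec.span {x}"
  shows "f \<in> scalar_torus X"
proof -
  obtain A where A: "\<And>x. x \<in> X \<Longrightarrow> f x = A *v x"
    using centralizer_linear[OF f] by blast
  obtain x0 where x0: "x0 \<in> X" "x0 \<noteq> 0" using nonzero by blast
  have "\<exists>l. A *v x = l *s x" if x: "x \<in> X" for x
  proof (cases "x = 0")
    case False
    then have "f x \<in> vec.span {x}"
      using lines[OF x] vec.span_base[of x "{x}"] by blast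
    then show ?thesis
      using A[OF x] by (auto simp: vec.span_singleton)
  qed simp
  then obtain l where l: "\<forall>x\<in>X. A *v x = l *s x"
    using scalar_if_all_eigenvectors[OF irreducible x0] by blast
  have "l \<noteq> 0"
    using centralizer_nonzero[OF f x0] A[OF x0(1)] l x0 by auto
  moreover have "f = scaling X l"
    using A l by (intro aut_group_eqI[OF centralizer_aut[OF f] scaling_aut[OF \<open>l \<noteq> 0\<close>]])
      (simp add: scaling_apply)
  ultimately show ?thesis
    by (auto simp: scalar_torus_eq)
qed

end

section \<open>The action on the projective variety\<close>

lemma irreducible_cone_affine_cone:
  fixes Z :: "('a::field_char_0 ^ 'n) set set"
  assumes "proj_variety Z" "irreducible_wrt affine_closed (affine_cone Z)"
  shows "irreducible_cone (affine_cone Z)"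
proof
  have Z: "Z \<subseteq> proj_space" "Z \<noteq> {}"
    using assms(1) by (auto simp: proj_variety_def proj_closed_def irreducible_wrt_def)
  have lines: "\<exists>x. x \<noteq> 0 \<and> L = vec.span {x}" if "L \<in> Z" for L
    using that Z(1) by (auto simp: proj_space_def)
  show "irreducible_wrt affine_closed (affine_cone Z)" by fact
  show "c *s x \<in> affine_cone Z" if x: "x \<in> affine_cone Z" for x c
  proof (cases "x = 0")
    case False
    then obtain L where L: "L \<in> Z" "x \<in> L"
      using x by (auto simp: affine_cone_def)
    then have "c *s x \<in> L"
      using lines[of L] vec.span_scale by blast
    then show ?thesis
      using L by (auto simp: affine_cone_def)
  qed (simp add: affine_cone_def)
  show "\<exists>x\<in>affine_cone Z. x \<noteq> 0"
  proof -
    obtain L where L: "L \<in> Z" using Z(2) by blast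
    then obtain x where "x \<noteq> 0" "L = vec.span {x}" using lines by blast
    then show ?thesis
      using L vec.span_base[of x "{x}"] by (auto simp: affine_cone_def)
  qed
qed

lemma line_eq_span:
  fixes L :: "('a::field ^ 'n) set"
  assumes "L \<in> proj_space" "x \<in> L" "x \<noteq> 0"
  shows "L = vec.span {x}"
proof -
  obtain y where y: "L = vec.span {y}"
    using assms(1) by (auto simp: proj_space_def)
  obtain k where k: "x = k *s y"
    using assms(2) y by (auto simp: vec.span_singleton)
  then have "k \<noteq> 0" using assms(3) by auto
  then have "vec.span {x} = vec.span {y}"
    unfolding k by (rule vec.span_image_scale[of "{y}" "\<lambda>_. k", simplified])
  then show ?thesis using y by simp
qed

lemma proj_closed_empty: "proj_closed ({} :: ('a::field ^ 'n) set set)"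
  unfolding proj_closed_def
proof (intro exI[of _ "{Poly_Mapping.single 0 (1 :: 'a)}"] conjI)
  show "\<forall>p\<in>{Poly_Mapping.single (0 :: 'n \<Rightarrow>\<^sub>0 nat) (1 :: 'a)}. \<exists>d. homogeneous_mpoly d p"
    by (auto simp: homogeneous_mpoly_def intro!: exI[of _ 0])
  have "mpoly_eval v (Poly_Mapping.single 0 (1 :: 'a)) = 1" for v :: "'n \<Rightarrow> 'a"
    using mpoly_eval_single[of v 0 1] by (simp add: monomial_value_def)
  moreover have "0 \<in> L" if "L \<in> proj_space" for L :: "('a ^ 'n) set"
    using that vec.span_zero by (auto simp: proj_space_def)
  ultimately show "{} = {L \<in> proj_space. \<forall>p\<in>{Poly_Mapping.single 0 (1 :: 'a)}. \<forall>x\<in>L :: ('a ^ 'n) set.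
      mpoly_eval (($) x) p = 0}"
    by auto
qed

lemma proj_morphism_cong:
  assumes "\<And>L. L \<in> Z \<Longrightarrow> f L = g L"
  shows "proj_morphism Z W f \<longleftrightarrow> proj_morphism Z W g"
proof -
  have "f \<in> Z \<rightarrow> W \<longleftrightarrow> g \<in> Z \<rightarrow> W"
    using assms by (auto simp: Pi_iff)
  moreover have "(\<forall>M \<in> Z - C. \<forall>x \<in> M - {0}. R x \<and> f M = S x) \<longleftrightarrow>
      (\<forall>M \<in> Z - C. \<forall>x \<in> M - {0}. R x \<and> g M = S x)" for C R S
    using assms by auto
  ultimately show ?thesis
    unfolding proj_morphism_def by simp
qed

locale cone_over_proj_variety = irreducible_cone "affine_cone Z"
  for Z :: "('a::field_char_0 ^ 'n) set set" +
  assumes variety: "proj_variety Z"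
begin

abbreviation "X \<equiv> affine_cone Z"

lemma subset_proj_space: "Z \<subseteq> proj_space"
  using variety by (auto simp: proj_variety_def proj_closed_def)

lemma mem_lineE:
  assumes "L \<in> Z"
  obtains x where "x \<in> X" "x \<noteq> 0" "L = vec.span {x}"
proof -
  obtain x where "x \<noteq> 0" "L = vec.span {x}"
    using assms subset_proj_space by (auto simp: proj_space_def)
  then show ?thesis
    using that assms vec.span_base[of x "{x}"] by (auto simp: affine_cone_def)
qed

lemma mem_X_if_mem_line: "L \<in> Z \<Longrightarrow> x \<in> L \<Longrightarrow> x \<in> X"
  by (auto simp: affine_cone_def)

lemma span_mem:
  assumes "x \<in> X" "x \<noteq> 0"
  shows "vec.span {x} \<in> Z"
proof -
  obtain L where "L \<in> Z" "x \<in> L"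
    using assms by (auto simp: affine_cone_def)
  then show ?thesis
    using line_eq_span[of L x] assms(2) subset_proj_space by auto
qed

definition induced_map :: "('a ^ 'n \<Rightarrow> 'a ^ 'n) \<Rightarrow> ('a ^ 'n) set \<Rightarrow> ('a ^ 'n) set"
  where "induced_map f = (\<lambda>L\<in>Z. f ` L)"

lemma image_mem:
  assumes "f \<in> centralizer" "L \<in> Z"
  shows "f ` L \<in> Z"
proof -
  obtain x where x: "x \<in> X" "x \<noteq> 0" "L = vec.span {x}"
    using mem_lineE[OF assms(2)] .
  then show ?thesis
    using assms(1) span_mem[of "f x"] centralizer_nonzero[OF assms(1) x(1,2)]
      aut_group_apply_closed[OF centralizer_aut[OF assms(1)] x(1)]
    by (simp add: centralizer_image_span)
qed

text \<open>The linear forms that describe \<open>f\<close> have no common zero on the nonzero points of the cone, so they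
  describe the induced map on all of \<open>Z\<close> at once.\<close>

lemma proj_morphism_induced_map:
  assumes f: "f \<in> centralizer"
  shows "proj_morphism Z Z (induced_map f)"
  unfolding proj_morphism_def
proof (intro conjI ballI)
  show "induced_map f \<in> Z \<rightarrow> Z"
    using image_mem[OF f] by (auto simp: induced_map_def)
  obtain A where A: "\<And>x. x \<in> X \<Longrightarrow> f x = A *v x"
    using centralizer_linear[OF f] by blast
  have "\<exists>p. homogeneous_mpoly 1 p \<and> (\<forall>v. mpoly_eval v p = (\<Sum>j\<in>UNIV. A $ i $ j * v j))" for i
    using homogeneous_linear_form[of "\<lambda>j. A $ i $ j"] by metis
  then obtain F where F: "\<And>i. homogeneous_mpoly 1 (F i)"
      "\<And>i v. mpoly_eval v (F i) = (\<Sum>j\<in>UNIV. A $ i $ j * v j)"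
    by metis
  have eval: "(\<chi> i. mpoly_eval (($) x) (F i)) = f x" if "x \<in> X" for x
    using A[OF that] by (simp add: F(2) matrix_vector_mult_def)
  fix L assume "L \<in> Z"
  show "\<exists>C d. \<exists>F :: 'n \<Rightarrow> ('n, 'a) mpoly. proj_closed C \<and> L \<notin> C \<and> (\<forall>i. homogeneous_mpoly d (F i)) \<and>
      (\<forall>M \<in> Z - C. \<forall>x \<in> M - {0}. (\<chi> i. mpoly_eval (($) x) (F i)) \<noteq> 0 \<and>
        induced_map f M = vec.span {\<chi> i. mpoly_eval (($) x) (F i)})"
  proof (intro exI[of _ "{}"] exI[of _ "1 :: nat"] exI[of _ F] conjI allI ballI)
    fix M x assume M: "M \<in> Z - {}" and x: "x \<in> M - {0}"
    then have X: "x \<in> X" and span: "M = vec.span {x}"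
      using mem_X_if_mem_line[of M x] line_eq_span[of M x] subset_proj_space by blast+
    show "(\<chi> i. mpoly_eval (($) x) (F i)) \<noteq> 0"
      using centralizer_nonzero[OF f X] x by (simp add: eval[OF X])
    have "f ` M = vec.span {f x}"
      unfolding span by (rule centralizer_image_span[OF f X])
    then show "induced_map f M = vec.span {\<chi> i. mpoly_eval (($) x) (F i)}"
      using M by (simp add: induced_map_def eval[OF X])
  qed (use F proj_closed_empty in auto)
qed

lemma induced_map_mult:
  assumes "f \<in> centralizer" "g \<in> centralizer"
  shows "induced_map (f \<otimes>\<^bsub>aut_group X\<^esub> g) = compose Z (induced_map f) (induced_map g)"
proof -
  have "(f \<otimes>\<^bsub>aut_group X\<^esub> g) ` L = f ` g ` L" if "L \<in> Z" for L
  proof -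
    have "(f \<otimes>\<^bsub>aut_group X\<^esub> g) x = f (g x)" if "x \<in> L" for x
      using mem_X_if_mem_line[OF \<open>L \<in> Z\<close> that] assms
      by (simp add: aut_group_mult centralizer_aut compose_eq)
    then show ?thesis by (auto simp: image_image)
  qed
  then show ?thesis
    unfolding induced_map_def compose_def
    by (intro restrict_ext) (simp add: image_mem[OF assms(2)])
qed

lemma induced_map_inv:
  assumes f: "f \<in> centralizer" and "L \<in> Z"
  shows "induced_map (inv\<^bsub>aut_group X\<^esub> f) (induced_map f L) = L"
    and "induced_map f (induced_map (inv\<^bsub>aut_group X\<^esub> f) L) = L"
proof -
  interpret group "aut_group X" by (rule group_aut_group)
  have inv: "inv\<^bsub>aut_group X\<^esub> f \<in> centralizer"
    using subgroup.m_inv_closed[OF subgroup_centralizer f] .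
  have one: "induced_map \<one>\<^bsub>aut_group X\<^esub> L = L"
    using mem_X_if_mem_line[OF assms(2)] assms(2) by (auto simp: induced_map_def aut_group_one image_iff)
  show "induced_map (inv\<^bsub>aut_group X\<^esub> f) (induced_map f L) = L"
    using induced_map_mult[OF inv f] one assms(2) centralizer_aut[OF f] by (simp add: compose_def fun_eq_iff)
  show "induced_map f (induced_map (inv\<^bsub>aut_group X\<^esub> f) L) = L"
    using induced_map_mult[OF f inv] one assms(2) centralizer_aut[OF f] by (simp add: compose_def fun_eq_iff)
qed

lemma induced_map_mem_proj_aut_group:
  assumes f: "f \<in> centralizer"
  shows "induced_map f \<in> carrier (proj_aut_group Z)"
proof -
  have inv: "inv\<^bsub>aut_group X\<^esub> f \<in> centralizer"
    using subgroup.m_inv_closed[OF subgroup_centralizer f] .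
  have closed: "induced_map g L \<in> Z" if "g \<in> centralizer" "L \<in> Z" for g L
    using image_mem[OF that] that by (simp add: induced_map_def)
  have bij: "bij_betw (induced_map f) Z Z"
    by (rule bij_betw_byWitness[of _ "induced_map (inv\<^bsub>aut_group X\<^esub> f)"])
       (auto simp: induced_map_inv[OF f] closed[OF f] closed[OF inv])
  then have "inv_into Z (induced_map f) L = induced_map (inv\<^bsub>aut_group X\<^esub> f) L" if "L \<in> Z" for L
    using that closed[OF inv that] induced_map_inv(2)[OF f that]
    by (intro inv_into_f_eq) (auto simp: bij_betw_def)
  then have "proj_morphism Z Z (inv_into Z (induced_map f))"
    using proj_morphism_cong proj_morphism_induced_map[OF inv] by blast
  then show ?thesis
    using bij proj_morphism_induced_map[OF f]
    by (simp add: proj_aut_group_def Bij_def induced_map_def)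
qed

lemma induced_map_mem_Bij: "f \<in> centralizer \<Longrightarrow> induced_map f \<in> Bij Z"
  using induced_map_mem_proj_aut_group by (simp add: proj_aut_group_def)

lemma mem_scalar_torus_if_induced_map_id:
  assumes "f \<in> centralizer" "induced_map f = (\<lambda>L\<in>Z. L)"
  shows "f \<in> scalar_torus X"
proof (rule mem_scalar_torus_if_preserves_lines[OF assms(1)])
  fix x assume "x \<in> X" "x \<noteq> 0"
  then have "vec.span {x} \<in> Z" by (rule span_mem)
  then show "f ` vec.span {x} = vec.span {x}"
    using fun_cong[OF assms(2), of "vec.span {x}"] by (simp add: induced_map_def)
qed

end

section \<open>Tori acting on rigid cones\<close>

lemma vec_nth_scale: "($) (c *s x) = (\<lambda>j. c * x $ j)"
  by (simp add: fun_eq_iff)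

lemma nat_pow_Gm: "u [^]\<^bsub>Gm\<^esub> n = u ^ n" for u :: "'a::field"
  by (induction n) (auto simp: Gm_def nat_pow_def mult.commute)

text \<open>Over an algebraically closed field every \<open>t\<close> is a power \<open>u ^ n\<close> with \<open>n\<close> the order of the image.\<close>

lemma hom_Gm_finite_image_trivial:
  fixes h :: "'a::alg_closed_field \<Rightarrow> 'g"
  assumes "group G" "h \<in> hom Gm G" "finite (h ` (UNIV - {0}))" "t \<noteq> 0"
  shows "h t = \<one>\<^bsub>G\<^esub>"
proof -
  interpret group G by fact
  interpret h: group_hom Gm G h
    using assms(1,2) group_Gm by (intro group_hom.intro group_hom_axioms.intro)
  have carrier: "carrier (Gm :: 'a monoid) = UNIV - {0}"
    by (simp add: Gm_def)
  let ?I = "h ` (UNIV - {0})"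
  have I: "subgroup ?I G"
    using h.img_is_subgroup by (simp add: carrier)
  define n where "n = card ?I"
  have "n > 0"
    unfolding n_def using assms(3) assms(4) by (auto simp: card_gt_0_iff)
  then obtain u where u: "u ^ n = t"
    using nth_root_exists by blast
  then have "u \<noteq> 0"
    using assms(4) \<open>n > 0\<close> by auto
  interpret I: group "G \<lparr>carrier := ?I\<rparr>"
    using subgroup.subgroup_is_group[OF I] assms(1) .
  have "h a \<otimes>\<^bsub>G\<^esub> h b = h b \<otimes>\<^bsub>G\<^esub> h a" if "a \<noteq> 0" "b \<noteq> 0" for a b
    using that h.hom_mult[of a b] h.hom_mult[of b a] by (simp add: Gm_def mult.commute)
  then interpret I: comm_group "G \<lparr>carrier := ?I\<rparr>"
    by (intro I.group_comm_groupI) auto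
  have "h u [^]\<^bsub>G\<lparr>carrier := ?I\<rparr>\<^esub> n = \<one>\<^bsub>G\<^esub>"
    using I.power_order_eq_one[of "h u"] assms(3) \<open>u \<noteq> 0\<close> by (simp add: n_def)
  then have "h u [^]\<^bsub>G\<^esub> n = \<one>\<^bsub>G\<^esub>"
    by (simp add: nat_pow_def)
  moreover have "h (u [^]\<^bsub>Gm\<^esub> n) = h u [^]\<^bsub>G\<^esub> n"
    using h.hom_nat_pow \<open>u \<noteq> 0\<close> by (simp add: carrier)
  ultimately show ?thesis
    by (simp add: nat_pow_Gm u)
qed

locale rigid_cone = cone_over_proj_variety Z
  for Z :: "('a::{alg_closed_field, field_char_0} ^ 'n) set set" +
  assumes rigid: "rigid (affine_cone Z)"
    and finite_aut: "finite (carrier (proj_aut_group Z))"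
begin

lemma Gm_action_mem_scalar_torus:
  assumes "Gm_action X \<beta>" "t \<noteq> 0"
  shows "\<beta> t \<in> scalar_torus X"
proof -
  interpret \<beta>: Gm_action X \<beta> by fact
  have centralizer: "\<beta> s \<in> centralizer" if "s \<noteq> 0" for s
  proof -
    have "\<beta> s (c *s x) = c *s \<beta> s x" if "c \<noteq> 0" "x \<in> X" for c x
      using Gm_actions_commute[OF rigid assms(1) Gm_action_scaling \<open>s \<noteq> 0\<close> that]
        \<beta>.apply_closed[OF \<open>s \<noteq> 0\<close>] that by (simp add: scaling_apply)
    then show ?thesis
      using \<beta>.aut[OF that] by (simp add: centralizer_def)
  qed
  let ?h = "\<lambda>s. induced_map (\<beta> s)"
  have "?h \<in> hom Gm (BijGroup Z)"
  proof (rule homI)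
    fix s assume "s \<in> carrier (Gm :: 'a monoid)"
    then have s: "s \<noteq> 0" by (simp add: Gm_def)
    then show "?h s \<in> carrier (BijGroup Z)"
      by (simp add: BijGroup_def induced_map_mem_Bij centralizer)
    fix r assume "r \<in> carrier (Gm :: 'a monoid)"
    then have r: "r \<noteq> 0" by (simp add: Gm_def)
    have "\<beta> (s \<otimes>\<^bsub>Gm\<^esub> r) = \<beta> s \<otimes>\<^bsub>aut_group X\<^esub> \<beta> r"
      using \<beta>.hom s r by (auto simp: hom_def Gm_def)
    then show "?h (s \<otimes>\<^bsub>Gm\<^esub> r) = ?h s \<otimes>\<^bsub>BijGroup Z\<^esub> ?h r"
      using s r by (simp add: induced_map_mult centralizer mult_BijGroup induced_map_mem_Bij)
  qed
  moreover have "finite (?h ` (UNIV - {0}))"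
    by (rule finite_subset[OF _ finite_aut]) (auto intro: induced_map_mem_proj_aut_group centralizer)
  ultimately have "?h t = \<one>\<^bsub>BijGroup Z\<^esub>"
    using hom_Gm_finite_image_trivial[OF group_BijGroup] assms(2) by blast
  then show ?thesis
    using mem_scalar_torus_if_induced_map_id[OF centralizer[OF assms(2)]] by (simp add: BijGroup_def)
qed

lemma scalar_torus_mult_closed:
  "f \<in> scalar_torus X \<Longrightarrow> g \<in> scalar_torus X \<Longrightarrow> f \<otimes>\<^bsub>aut_group X\<^esub> g \<in> scalar_torus X"
  by (auto simp: scalar_torus_eq scaling_mult)

lemma one_mem_scalar_torus: "\<one>\<^bsub>aut_group X\<^esub> \<in> scalar_torus X"
  unfolding scaling_one[symmetric] by (auto simp: scalar_torus_eq)

text \<open>A torus is the product of its one-dimensional factors, and each factor acts by scalars.\<close>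

lemma subtorus_subset_scalar_torus:
  assumes "subtorus X S"
  shows "S \<subseteq> scalar_torus X"
proof -
  obtain s \<phi> where S: "subgroup S (aut_group X)"
    and iso: "\<phi> \<in> iso (torus s) ((aut_group X)\<lparr>carrier := S\<rparr>)"
    and morphism: "action_morphism (carrier (torus s)) (torus_coords s) X \<phi>"
    using assms by (auto simp: subtorus_def subtorus_of_dim_def)
  have carrier: "carrier (torus s) = {..<s} \<rightarrow>\<^sub>E (UNIV - {0 :: 'a})"
    by (simp add: torus_def Gm_def)
  have mult: "t \<otimes>\<^bsub>torus s\<^esub> u = (\<lambda>i\<in>{..<s}. t i * u i)" for t u :: "nat \<Rightarrow> 'a"
    by (simp add: torus_def Gm_def)
  have \<phi>_mem: "\<phi> t \<in> S" if "t \<in> carrier (torus s)" for t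
    using iso that by (auto simp: iso_def hom_def)
  have \<phi>_aut: "\<phi> t \<in> carrier (aut_group X)" if "t \<in> carrier (torus s)" for t
    using \<phi>_mem[OF that] subgroup.subset[OF S] by blast
  have \<phi>_mult: "\<phi> (t \<otimes>\<^bsub>torus s\<^esub> u) = \<phi> t \<otimes>\<^bsub>aut_group X\<^esub> \<phi> u"
    if "t \<in> carrier (torus s)" "u \<in> carrier (torus s)" for t u
    using iso that by (auto simp: iso_def hom_def)
  \<comment> \<open>the embedding of the \<open>k\<close>-th factor into the torus\<close>
  define factor where "factor k c = (\<lambda>i\<in>{..<s}. if i = k then c else 1)" for k and c :: 'a
  have factor_mem: "factor k c \<in> carrier (torus s)" if "c \<noteq> 0" for k c
    using that by (auto simp: factor_def carrier)
  have factor: "Gm_action X (\<lambda>c. \<phi> (factor k c))" for k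
  proof
    show "(\<lambda>c. \<phi> (factor k c)) \<in> hom Gm (aut_group X)"
    proof (rule homI)
      fix c assume "c \<in> carrier (Gm :: 'a monoid)"
      then have c: "c \<noteq> 0" by (simp add: Gm_def)
      then show "\<phi> (factor k c) \<in> carrier (aut_group X)"
        using \<phi>_aut factor_mem by blast
      fix d assume "d \<in> carrier (Gm :: 'a monoid)"
      then have d: "d \<noteq> 0" by (simp add: Gm_def)
      have "factor k (c * d) = factor k c \<otimes>\<^bsub>torus s\<^esub> factor k d"
        by (auto simp: mult factor_def)
      then show "\<phi> (factor k (c \<otimes>\<^bsub>Gm\<^esub> d)) = \<phi> (factor k c) \<otimes>\<^bsub>aut_group X\<^esub> \<phi> (factor k d)"
        using \<phi>_mult[OF factor_mem[OF c] factor_mem[OF d]] by (simp add: Gm_def)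
    qed
  next
    fix i
    obtain F where F: "polynomial_map F" "\<And>t x. t \<in> carrier (torus s) \<Longrightarrow> x \<in> X \<Longrightarrow>
        \<phi> t x $ i = F (case_sum (torus_coords s t) (($) x))"
      using morphism unfolding action_morphism_iff by blast
    have "laurent X (\<lambda>c x. F (\<lambda>j. case_sum (torus_coords s (factor k c)) (($) x) j))"
    proof (rule laurent_polynomial_map[OF F(1)])
      fix j :: "(nat + nat) + 'n"
      have power: "laurent X (\<lambda>c x. c powi w)" for w
        by (rule laurent_monomial[OF const_regular[of X 1], where w = w]) (simp add: restrict0_def)
      consider l where "j = Inl (Inl l)" | l where "j = Inl (Inr l)" | l where "j = Inr l"
        by (metis sum.exhaust)
      then show "laurent X (\<lambda>c x. case_sum (torus_coords s (factor k c)) (($) x) j)"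
      proof cases
        case (1 l)
        then show ?thesis
          using power[of 1] laurent_const[of X]
          by (cases "l < s"; cases "l = k") (simp_all add: torus_coords_def factor_def)
      next
        case (2 l)
        then show ?thesis
          using power[of "-1"] laurent_const[of X]
          by (cases "l < s"; cases "l = k") (simp_all add: torus_coords_def factor_def power_int_minus)
      next
        case (3 l)
        then show ?thesis
          using laurent_monomial[OF coordinate_regular[of X l], of "\<lambda>c x. x $ l" 0]
          by (simp add: coordinate_apply)
      qed
    qed
    then show "laurent X (\<lambda>c x. \<phi> (factor k c) x $ i)"
      by (rule laurent_cong) (simp add: F(2) factor_mem)
  qed
  have "\<phi> t \<in> scalar_torus X" if t: "t \<in> carrier (torus s)" for t
  proof -
    \<comment> \<open>\<open>part k\<close> is the product of the first \<open>k\<close> factors of \<open>t\<close>\<close>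
    define part where "part k = (\<lambda>i\<in>{..<s}. if i < k then t i else 1)" for k :: nat
    have t_nonzero: "t i \<noteq> 0" if "i < s" for i
      using t that by (auto simp: carrier)
    have part_mem: "part k \<in> carrier (torus s)" for k
      using t_nonzero by (auto simp: carrier part_def)
    have "k \<le> s \<Longrightarrow> \<phi> (part k) \<in> scalar_torus X" for k
    proof (induction k)
      case 0
      have "part 0 = \<one>\<^bsub>torus s\<^esub>"
        by (auto simp: part_def torus_def Gm_def)
      moreover have "\<phi> \<one>\<^bsub>torus s\<^esub> = \<one>\<^bsub>aut_group X\<^esub>"
      proof (rule hom_one[of \<phi> "torus s" "aut_group X"])
        show "\<phi> \<in> hom (torus s) (aut_group X)"
          using \<phi>_aut \<phi>_mult by (auto simp: hom_def)
        show "group (torus s :: (nat \<Rightarrow> 'a) monoid)"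
          by (simp add: torus_def group_Gm)
      qed (rule group_aut_group)
      ultimately show ?case
        by (simp add: one_mem_scalar_torus)
    next
      case (Suc k)
      then have k: "t k \<noteq> 0" using t_nonzero by simp
      have "part (Suc k) = part k \<otimes>\<^bsub>torus s\<^esub> factor k (t k)"
        by (auto simp: part_def mult factor_def less_Suc_eq)
      then have "\<phi> (part (Suc k)) = \<phi> (part k) \<otimes>\<^bsub>aut_group X\<^esub> \<phi> (factor k (t k))"
        using \<phi>_mult[OF part_mem factor_mem[OF k]] by simp
      then show ?case
        using Suc Gm_action_mem_scalar_torus[OF factor k] scalar_torus_mult_closed by simp
    qed
    moreover have "part s = t"
      using t by (auto simp: part_def carrier PiE_def extensional_def)
    ultimately show ?thesis by auto
  qed
  moreover have "S = \<phi> ` carrier (torus s)"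
    using iso by (auto simp: iso_def bij_betw_def)
  ultimately show ?thesis by auto
qed

lemma conjugate_scaling:
  assumes g: "g \<in> carrier (aut_group X)"
  shows "Gm_action X (\<lambda>t. g \<otimes>\<^bsub>aut_group X\<^esub> scaling X t \<otimes>\<^bsub>aut_group X\<^esub> inv\<^bsub>aut_group X\<^esub> g)"
    (is "Gm_action X ?\<beta>")
proof
  interpret group "aut_group X" by (rule group_aut_group)
  show "?\<beta> \<in> hom Gm (aut_group X)"
  proof (rule homI)
    fix s t assume "s \<in> carrier (Gm :: 'a monoid)" "t \<in> carrier (Gm :: 'a monoid)"
    then have st: "s \<noteq> 0" "t \<noteq> 0" by (auto simp: Gm_def)
    then have [simp]: "scaling X s \<in> carrier (aut_group X)" "scaling X t \<in> carrier (aut_group X)"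
      by (auto intro: scaling_aut)
    show "?\<beta> s \<in> carrier (aut_group X)" using g by simp
    have "?\<beta> s \<otimes>\<^bsub>aut_group X\<^esub> ?\<beta> t =
        g \<otimes>\<^bsub>aut_group X\<^esub> (scaling X s \<otimes>\<^bsub>aut_group X\<^esub> scaling X t) \<otimes>\<^bsub>aut_group X\<^esub> inv\<^bsub>aut_group X\<^esub> g"
      using g by (simp add: m_assoc inv_solve_left' flip: m_assoc[of "inv\<^bsub>aut_group X\<^esub> g" g])
    then show "?\<beta> (s \<otimes>\<^bsub>Gm\<^esub> t) = ?\<beta> s \<otimes>\<^bsub>aut_group X\<^esub> ?\<beta> t"
      using st by (simp add: scaling_mult Gm_def)
  qed
next
  interpret group "aut_group X" by (rule group_aut_group)
  fix i
  let ?k = "inv\<^bsub>aut_group X\<^esub> g"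
  have k: "?k \<in> carrier (aut_group X)" using g by simp
  obtain F where F: "polynomial_map F" "\<And>x. x \<in> X \<Longrightarrow> g x $ i = F (($) x)"
    using g by (auto simp: mem_aut_group_iff affine_morphism_iff)
  have "laurent X (\<lambda>t x. F (\<lambda>j. t * ?k x $ j))"
  proof (rule laurent_polynomial_map[OF F(1)])
    fix j
    show "laurent X (\<lambda>t x. t * ?k x $ j)"
      by (rule laurent_monomial[OF aut_group_regular_compose[OF k coordinate_regular[of X j]], where w = 1])
         (simp add: restrict0_def coordinate_apply aut_group_apply_closed[OF k])
  qed
  then show "laurent X (\<lambda>t x. ?\<beta> t x $ i)"
  proof (rule laurent_cong)
    fix t :: 'a and x assume t: "t \<noteq> 0" and x: "x \<in> X"
    have "?\<beta> t x = g (t *s ?k x)"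
      using g k x scaling_aut[OF t] aut_group_apply_closed[OF k x]
      by (simp add: aut_group_mult_apply scaling_apply)
    then show "F (\<lambda>j. t * ?k x $ j) = ?\<beta> t x $ i"
      using F(2)[OF cone[OF aut_group_apply_closed[OF k x]], of t]
      by (simp add: vec_nth_scale)
  qed
qed

section \<open>Centrality of the scalars and finiteness of the quotient\<close>

text \<open>Conjugation by \<open>g\<close> turns the scalar action into another action of the multiplicative group, which
  is again by scalars. The factor \<open>P t\<close> is a polynomial in \<open>t\<close> because it can be read off from a
  coordinate of \<open>g\<close> along one line.\<close>

lemma aut_group_semilinear:
  assumes g: "g \<in> carrier (aut_group X)"
  obtains P where "\<And>t. t \<noteq> 0 \<Longrightarrow> poly P t \<noteq> 0"
    and "\<And>t x. t \<noteq> 0 \<Longrightarrow> x \<in> X \<Longrightarrow> g (t *s x) = poly P t *s g x"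
proof -
  interpret group "aut_group X" by (rule group_aut_group)
  let ?k = "inv\<^bsub>aut_group X\<^esub> g"
  have k: "?k \<in> carrier (aut_group X)" using g by simp
  have "\<exists>c. c \<noteq> 0 \<and> (\<forall>x\<in>X. g (t *s x) = c *s g x)" if t: "t \<noteq> 0" for t
  proof -
    have "g \<otimes>\<^bsub>aut_group X\<^esub> scaling X t \<otimes>\<^bsub>aut_group X\<^esub> ?k \<in> scalar_torus X"
      by (rule Gm_action_mem_scalar_torus[OF conjugate_scaling[OF g] t])
    then obtain c where c: "c \<noteq> 0" "g \<otimes>\<^bsub>aut_group X\<^esub> scaling X t \<otimes>\<^bsub>aut_group X\<^esub> ?k = scaling X c"
      by (auto simp: scalar_torus_eq)
    have eq: "g \<otimes>\<^bsub>aut_group X\<^esub> scaling X t = scaling X c \<otimes>\<^bsub>aut_group X\<^esub> g"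
      using c g scaling_aut[OF t] scaling_aut[OF c(1)] inv_solve_right' by (metis inv_closed inv_inv m_closed)
    have "g (t *s x) = c *s g x" if "x \<in> X" for x
    proof -
      have "g (t *s x) = (g \<otimes>\<^bsub>aut_group X\<^esub> scaling X t) x"
        using that g scaling_aut[OF t] by (simp add: aut_group_mult_apply scaling_apply)
      also have "\<dots> = (scaling X c \<otimes>\<^bsub>aut_group X\<^esub> g) x"
        by (simp only: eq)
      also have "\<dots> = c *s g x"
        using that g scaling_aut[OF c(1)] aut_group_apply_closed[OF g that]
        by (simp add: aut_group_mult_apply scaling_apply)
      finally show ?thesis .
    qed
    then show ?thesis using c(1) by blast
  qed
  then obtain a where a: "\<And>t. t \<noteq> 0 \<Longrightarrow> a t \<noteq> 0"
      "\<And>t x. t \<noteq> 0 \<Longrightarrow> x \<in> X \<Longrightarrow> g (t *s x) = a t *s g x"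
    by metis
  obtain y where y: "y \<in> X" "y \<noteq> 0" using nonzero by blast
  define x where "x = ?k y"
  have x: "x \<in> X" "g x = y"
    using aut_group_apply_closed[OF k y(1)] aut_group_inv_apply(2)[OF g y(1)] by (auto simp: x_def)
  obtain i where i: "y $ i \<noteq> 0"
    using y(2) by (auto simp: vec_eq_iff)
  obtain F where F: "polynomial_map F" "\<And>x. x \<in> X \<Longrightarrow> g x $ i = F (($) x)"
    using g by (auto simp: mem_aut_group_iff affine_morphism_iff)
  obtain p where p: "\<And>c. F (\<lambda>j. c * x $ j) = poly p c"
    using polynomial_map_on_line[OF F(1)] by metis
  have "a t = poly (smult (inverse (y $ i)) p) t" if "t \<noteq> 0" for t
  proof -
    have "a t * y $ i = g (t *s x) $ i"
      using a(2)[OF that x(1)] x(2) by simp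
    also have "\<dots> = poly p t"
      using F(2)[OF cone[OF x(1)], of t] p[of t] by (simp add: vec_nth_scale)
    finally show ?thesis
      using i by (simp add: field_simps)
  qed
  then show ?thesis
    using that[of "smult (inverse (y $ i)) p"] a by metis
qed

text \<open>If \<open>P\<close> and \<open>Q\<close> belong to \<open>g\<close> and its inverse, then \<open>Q \<circ> P\<close> is the identity, so \<open>P\<close> is linear. It
  has no nonzero root and its value at \<open>1\<close> is \<open>1\<close>.\<close>

lemma aut_group_eq_centralizer: "carrier (aut_group X) = centralizer"
proof
  show "carrier (aut_group X) \<subseteq> centralizer"
  proof
    interpret group "aut_group X" by (rule group_aut_group)
    fix g assume g: "g \<in> carrier (aut_group X)"
    obtain P where P: "\<And>t. t \<noteq> 0 \<Longrightarrow> poly P t \<noteq> 0"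
        "\<And>t x. t \<noteq> 0 \<Longrightarrow> x \<in> X \<Longrightarrow> g (t *s x) = poly P t *s g x"
      using aut_group_semilinear[OF g] by blast
    obtain Q where Q: "\<And>t. t \<noteq> 0 \<Longrightarrow> poly Q t \<noteq> 0"
        "\<And>t x. t \<noteq> 0 \<Longrightarrow> x \<in> X \<Longrightarrow> (inv\<^bsub>aut_group X\<^esub> g) (t *s x) = poly Q t *s (inv\<^bsub>aut_group X\<^esub> g) x"
      using aut_group_semilinear[OF inv_closed[OF g]] by blast
    obtain y where y: "y \<in> X" "y \<noteq> 0" using nonzero by blast
    have "pcompose Q P = [:0, 1:]"
    proof (rule poly_eq_if_eq_nonzero)
      fix t :: 'a assume t: "t \<noteq> 0"
      have "t *s y = (inv\<^bsub>aut_group X\<^esub> g) (g (t *s y))"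
        using aut_group_inv_apply(1)[OF g cone[OF y(1)]] by simp
      also have "\<dots> = poly Q (poly P t) *s y"
        using P(2)[OF t y(1)] Q(2)[OF P(1)[OF t] aut_group_apply_closed[OF g y(1)]]
          aut_group_inv_apply(1)[OF g y(1)] by simp
      finally show "poly (pcompose Q P) t = poly [:0, 1:] t"
        using y(2) by (simp add: poly_pcompose)
    qed
    then have "degree Q * degree P = 1"
      by (metis degree_pcompose degree_pCons_eq_if one_neq_zero degree_0 one_pCons Suc_eq_plus1 add_0 One_nat_def pCons_eq_0_iff)
    then have "degree P = 1" by simp
    then obtain a b where ab: "P = [:a, b:]" "b \<noteq> 0"
      by (metis degree1_coeffs)
    have "a = 0"
    proof (rule ccontr)
      assume "a \<noteq> 0"
      then have "poly P (- a / b) \<noteq> 0"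
        using ab by (intro P) simp
      then show False using ab by simp
    qed
    then have P_eq: "poly P t = b * t" for t
      using ab by (simp add: mult.commute)
    let ?x = "(inv\<^bsub>aut_group X\<^esub> g) y"
    have "g ?x = b *s g ?x"
      using P(2)[of 1 ?x] aut_group_apply_closed[OF inv_closed[OF g] y(1)] by (simp add: P_eq)
    then have "1 *s y = b *s y"
      using aut_group_inv_apply(2)[OF g y(1)] by simp
    then have "b = 1"
      using y(2) by (metis vector_mul_rcancel)
    then show "g \<in> centralizer"
      using g P(2) by (simp add: centralizer_def P_eq)
  qed
qed (auto simp: centralizer_def)

lemma scaling_central:
  assumes "c \<noteq> 0" "g \<in> carrier (aut_group X)"
  shows "scaling X c \<otimes>\<^bsub>aut_group X\<^esub> g = g \<otimes>\<^bsub>aut_group X\<^esub> scaling X c"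
proof -
  have "g \<in> centralizer" using assms(2) aut_group_eq_centralizer by simp
  then show ?thesis
    unfolding aut_group_mult[OF scaling_aut[OF assms(1)] assms(2)]
      aut_group_mult[OF assms(2) scaling_aut[OF assms(1)]]
    by (auto simp: compose_def scaling_apply aut_group_apply_closed[OF assms(2)] centralizer_scale)
qed

lemma subgroup_scalar_torus: "subgroup (scalar_torus X) (aut_group X)"
proof -
  interpret group "aut_group X" by (rule group_aut_group)
  show ?thesis
  proof (rule subgroupI)
    fix f assume "f \<in> scalar_torus X"
    then obtain c where c: "c \<noteq> 0" "f = scaling X c" by (auto simp: scalar_torus_eq)
    have "scaling X (inverse c) \<otimes>\<^bsub>aut_group X\<^esub> scaling X c = \<one>\<^bsub>aut_group X\<^esub>"
      using c by (simp add: scaling_mult scaling_one)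
    then have "inv\<^bsub>aut_group X\<^esub> f = scaling X (inverse c)"
      using c by (intro inv_equality) (auto intro: scaling_aut)
    then show "inv\<^bsub>aut_group X\<^esub> f \<in> scalar_torus X"
      using c by (auto simp: scalar_torus_eq)
  qed (auto simp: scalar_torus_mult_closed intro: one_mem_scalar_torus,
       auto simp: scalar_torus_eq intro: scaling_aut)
qed

lemma subtorus_scalar_torus: "subtorus_of_dim 1 X (scalar_torus X)"
proof -
  let ?\<phi> = "\<lambda>t :: nat \<Rightarrow> 'a. scaling X (t 0)"
  have carrier: "carrier (torus 1) = {..<1} \<rightarrow>\<^sub>E (UNIV - {0 :: 'a})"
    by (simp add: torus_def Gm_def)
  have mult: "t \<otimes>\<^bsub>torus 1\<^esub> u = (\<lambda>i\<in>{..<1}. t i * u i)" for t u :: "nat \<Rightarrow> 'a"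
    by (simp add: torus_def Gm_def)
  have nonzero_t: "t 0 \<noteq> 0" if "t \<in> carrier (torus 1)" for t :: "nat \<Rightarrow> 'a"
    using that unfolding carrier by auto
  obtain y where y: "y \<in> X" "y \<noteq> 0" using nonzero by blast
  have "?\<phi> \<in> iso (torus 1) ((aut_group X)\<lparr>carrier := scalar_torus X\<rparr>)"
    unfolding iso_def
  proof (intro CollectI conjI)
    show "?\<phi> \<in> hom (torus 1) ((aut_group X)\<lparr>carrier := scalar_torus X\<rparr>)"
      by (rule homI) (auto simp: mult scaling_mult nonzero_t scalar_torus_eq simp del: One_nat_def)
    have "inj_on ?\<phi> (carrier (torus 1))"
    proof (rule inj_onI)
      fix t u assume tu: "t \<in> carrier (torus 1)" "u \<in> carrier (torus 1)" "?\<phi> t = ?\<phi> u"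
      then have "t 0 *s y = u 0 *s y"
        using y(1) scaling_apply by metis
      then have "t 0 = u 0" using y(2) by simp
      then show "t = u"
        using tu(1,2) unfolding carrier by (intro PiE_ext) auto
    qed
    moreover have "?\<phi> ` carrier (torus 1) = scalar_torus X"
    proof
      show "scalar_torus X \<subseteq> ?\<phi> ` carrier (torus 1)"
      proof
        fix f assume "f \<in> scalar_torus X"
        then obtain c where c: "c \<noteq> 0" "f = scaling X c" by (auto simp: scalar_torus_eq)
        then show "f \<in> ?\<phi> ` carrier (torus 1)"
          by (intro image_eqI[of _ _ "\<lambda>i\<in>{..<1}. c"]) (auto simp: carrier simp del: One_nat_def)
      qed
    qed (auto simp: scalar_torus_eq nonzero_t simp del: One_nat_def)
    ultimately show "bij_betw ?\<phi> (carrier (torus 1)) (carrier ((aut_group X)\<lparr>carrier := scalar_torus X\<rparr>))"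
      by (simp add: bij_betw_def)
  qed
  moreover have "action_morphism (carrier (torus 1)) (torus_coords 1) X ?\<phi>"
    unfolding action_morphism_iff
    by (intro exI[of _ "\<lambda>i v. v (Inl (Inl 0)) * v (Inr i)"] allI conjI ballI)
       (auto intro: polynomial_map_mult polynomial_map_var simp: scaling_apply torus_coords_def)
  ultimately show ?thesis
    unfolding subtorus_of_dim_def using subgroup_scalar_torus by blast
qed

lemma normal_scalar_torus: "scalar_torus X \<lhd> aut_group X"
proof -
  interpret group "aut_group X" by (rule group_aut_group)
  show ?thesis
    unfolding normal_inv_iff
  proof (intro conjI ballI subgroup_scalar_torus)
    fix g f assume g: "g \<in> carrier (aut_group X)" and "f \<in> scalar_torus X"
    then obtain c where c: "c \<noteq> 0" "f = scaling X c" by (auto simp: scalar_torus_eq)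
    have "g \<otimes>\<^bsub>aut_group X\<^esub> f \<otimes>\<^bsub>aut_group X\<^esub> inv\<^bsub>aut_group X\<^esub> g = f"
      using c g scaling_aut[OF c(1)] scaling_central[OF c(1) g, symmetric] by (simp add: m_assoc)
    then show "g \<otimes>\<^bsub>aut_group X\<^esub> f \<otimes>\<^bsub>aut_group X\<^esub> inv\<^bsub>aut_group X\<^esub> g \<in> scalar_torus X"
      using \<open>f \<in> scalar_torus X\<close> by simp
  qed
qed

lemma rcoset_eq_if_induced_map_eq:
  assumes "f \<in> carrier (aut_group X)" "g \<in> carrier (aut_group X)" "induced_map f = induced_map g"
  shows "scalar_torus X #>\<^bsub>aut_group X\<^esub> f = scalar_torus X #>\<^bsub>aut_group X\<^esub> g"
proof -
  interpret group "aut_group X" by (rule group_aut_group)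
  have cent: "f \<in> centralizer" "g \<in> centralizer" "inv\<^bsub>aut_group X\<^esub> g \<in> centralizer"
    using assms aut_group_eq_centralizer inv_closed by auto
  let ?h = "f \<otimes>\<^bsub>aut_group X\<^esub> inv\<^bsub>aut_group X\<^esub> g"
  have "induced_map ?h = compose Z (induced_map g) (induced_map (inv\<^bsub>aut_group X\<^esub> g))"
    using assms(3) cent by (simp add: induced_map_mult)
  also have "\<dots> = (\<lambda>L\<in>Z. L)"
    unfolding compose_def by (intro restrict_ext induced_map_inv(2)[OF cent(2)])
  finally have "?h \<in> scalar_torus X"
    using assms cent aut_group_eq_centralizer
    by (intro mem_scalar_torus_if_induced_map_id) auto
  moreover have "f = ?h \<otimes>\<^bsub>aut_group X\<^esub> g"
    using assms by (simp add: m_assoc)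
  ultimately have "f \<in> scalar_torus X #>\<^bsub>aut_group X\<^esub> g"
    unfolding r_coset_def by blast
  then show ?thesis
    using repr_independence[OF _ assms(2) subgroup_scalar_torus] by simp
qed

lemma finite_quotient: "finite (carrier (aut_group X Mod scalar_torus X))"
proof -
  let ?c = "\<lambda>f. scalar_torus X #>\<^bsub>aut_group X\<^esub> f"
  have fin: "finite (induced_map ` carrier (aut_group X))"
    by (rule finite_subset[OF _ finite_aut])
       (auto simp: aut_group_eq_centralizer intro: induced_map_mem_proj_aut_group)
  have "?c ` carrier (aut_group X) \<subseteq>
      (\<lambda>h. ?c (SOME f. f \<in> carrier (aut_group X) \<and> induced_map f = h)) ` induced_map ` carrier (aut_group X)"
  proof clarify
    fix f assume f: "f \<in> carrier (aut_group X)"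
    let ?g = "SOME g. g \<in> carrier (aut_group X) \<and> induced_map g = induced_map f"
    have g: "?g \<in> carrier (aut_group X) \<and> induced_map ?g = induced_map f"
      by (rule someI[of _ f]) (simp add: f)
    have "?c f = ?c ?g"
      by (rule rcoset_eq_if_induced_map_eq[OF f conjunct1[OF g] conjunct2[OF g, symmetric]])
    then show "?c f \<in> (\<lambda>h. ?c (SOME f. f \<in> carrier (aut_group X) \<and> induced_map f = h)) `
        induced_map ` carrier (aut_group X)"
      using f by blast
  qed
  moreover have "carrier (aut_group X Mod scalar_torus X) = ?c ` carrier (aut_group X)"
    by (auto simp: FactGroup_def RCOSETS_def)
  ultimately show ?thesis
    using finite_subset[OF _ finite_imageI[OF fin]] by (simp only:)
qed

end

theorem proposition2:
  fixes Z :: "('a::{alg_closed_field, field_char_0} ^ 'n) set set"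
    and X :: "('a ^ 'n) set"
  assumes "proj_variety Z"
    and "finite (carrier (proj_aut_group Z))"
    and "X = affine_cone Z"
    and "rigid X"
  shows "is_maximal_torus X (scalar_torus X)
    \<and> subtorus_of_dim 1 X (scalar_torus X)
    \<and> scalar_torus X \<lhd> aut_group X
    \<and> finite (carrier (aut_group X Mod scalar_torus X))
    \<and> (\<forall>t \<in> scalar_torus X. \<forall>g \<in> carrier (aut_group X).
          t \<otimes>\<^bsub>aut_group X\<^esub> g = g \<otimes>\<^bsub>aut_group X\<^esub> t)"
proof -
  interpret irreducible_cone "affine_cone Z"
    using assms by (intro irreducible_cone_affine_cone) (auto simp: rigid_def affine_variety_def)
  interpret rigid_cone Z
    using assms by unfold_locales auto
  have "is_maximal_torus (affine_cone Z) (scalar_torus (affine_cone Z))"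
    using subtorus_scalar_torus subtorus_subset_scalar_torus
    by (auto simp: is_maximal_torus_def subtorus_def)
  moreover have "\<forall>t \<in> scalar_torus (affine_cone Z). \<forall>g \<in> carrier (aut_group (affine_cone Z)).
      t \<otimes>\<^bsub>aut_group (affine_cone Z)\<^esub> g = g \<otimes>\<^bsub>aut_group (affine_cone Z)\<^esub> t"
    using scaling_central by (auto simp: scalar_torus_eq)
  ultimately show ?thesis
    unfolding assms(3) using subtorus_scalar_torus normal_scalar_torus finite_quotient by blast
qed

end
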